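(* Let $n\geqslant k\geqslant 2$ and let $S=(v_1,\ldots,v_n)$ be an $(n,k)$-uframe at which the function $F(S')=\vol\left(\mathop{\rm co}\{\pm v'_1,\ldots,\pm v'_n\}\right)$, $S'=(v'_1,\dots,v'_n)\in\Omega(n,k)$, attains a local maximum on $\Omega(n,k)$. Let $P=\mathop{\rm co}\{\pm v_1,\ldots,\pm v_n\}$. Then $P$ is a simplicial polytope, and for every vertex $v$ of $P$, $$|v|^2=\frac{\vol N_P(v)}{\vol P}.$$
   Context: An $(n,k)$-frame is an ordered $n$-tuple of vectors in $\mathbb{R}^k$ spanning $\mathbb{R}^k$ (repetitions and zero vectors allowed). It is an $(n,k)$-uframe if $\sum_{i=1}^n v_i\otimes v_i=I_k$ (i.e. $\sum v_iv_i^T$ is the identity). $\Omega(n,k)$ is the set of all $(n,k)$-uframes, viewed as a subset of $\mathbb{R}^{k\times n}$ with the Euclidean topology; local maximum is with respect to this topology. $\vol$ is $k$-dimensional volume and $|\cdot|$ the Euclidean norm. For a centrally symmetric polytope $P\subset\mathbb{R}^k$ and a vertex $v$ of $P$, the star of $v$ is $N_P(v)=\bigcup \mathop{\rm co}(F\cup\{0\})$, the union over all facets $F$ of $P$ containing $v$ or containing $-v$. *)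

theory Defs
  imports "HOL-Analysis.Analysis"
begin

definition frame :: "(real^'k)^'n \<Rightarrow> bool" where
  "frame S \<longleftrightarrow> span (range (\<lambda>i. S $ i)) = UNIV"

definition outer :: "real^'k \<Rightarrow> real^'k^'k" where
  "outer v = (\<chi> a b. v $ a * v $ b)"

definition uframe :: "(real^'k)^'n \<Rightarrow> bool" where
  "uframe S \<longleftrightarrow> frame S \<and> (\<Sum>i\<in>UNIV. outer (S $ i)) = mat 1"

definition Omega :: "((real^'k)^'n) set" where
  "Omega = {S. uframe S}"

definition symhull :: "(real^'k)^'n \<Rightarrow> (real^'k) set" where
  "symhull S = convex hull ((\<lambda>i. S $ i) ` UNIV \<union> (\<lambda>i. - (S $ i)) ` UNIV)"

definition vol_fun :: "(real^'k)^'n \<Rightarrow> real" where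
  "vol_fun S = measure lebesgue (symhull S)"

definition simplicial_polytope :: "'a::euclidean_space set \<Rightarrow> bool" where
  "simplicial_polytope P \<longleftrightarrow> polytope P \<and> (\<forall>F. F facet_of P \<longrightarrow> (\<exists>m. m simplex F))"

definition star :: "'a::euclidean_space set \<Rightarrow> 'a \<Rightarrow> 'a set" where
  "star P v = \<Union> {convex hull (F \<union> {0}) | F. F facet_of P \<and> (v \<in> F \<or> - v \<in> F)}"

end

theory Submission
  imports Defs
begin

text \<open>Scale one vector \<open>v = v\<^sub>i\<close> by \<open>\<tau>\<close> and restore the tight-frame condition by the inverse square root of
  the frame operator. Local maximality then gives \<open>f \<tau> \<le> V * sqrt (1 + (\<tau>\<^sup>2 - 1) * |v|\<^sup>2)\<close> near \<open>\<tau> = 1\<close>, with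
  equality at 1, where \<open>f \<tau>\<close> is the volume of the convex hull of \<open>K\<close> and \<open>\<plusminus>\<tau> v\<close>, \<open>K\<close> is the symmetric hull
  of the other vectors and \<open>V = f 1\<close>.

  The hull of \<open>K\<close> and a point \<open>w\<close> is \<open>K\<close> together with the pyramids from \<open>w\<close> over the facets of \<open>K\<close> visible
  from \<open>w\<close>. For a facet in the hyperplane \<open>a \<bullet> x = 1\<close> such a pyramid is \<open>a \<bullet> w - 1\<close> times as large as the
  cone over the facet from the origin. Hence \<open>f\<close> is a sum of functions \<open>max 0 (\<tau> * |a \<bullet> v| - 1) * c\<^sub>a\<close>: it is
  convex and piecewise linear, with a kink at 1 exactly when \<open>\<plusminus>v\<close> lies in the hyperplane of a facet of \<open>K\<close>.
  (If \<open>K\<close> is contained in a hyperplane, \<open>f\<close> is linear.)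

  A convex function touching a smooth one from below is differentiable there. So \<open>f\<close> has no kink, and
  \<open>f' 1 = V * |v|\<^sup>2\<close>; the same pyramid formula applied to \<open>P\<close> itself shows that the right derivative is the
  volume of the star of \<open>v\<close>. If a facet of \<open>P\<close> had affinely dependent vertices, one of them, \<open>v\<close>, would lie
  in the affine hull of the others, which span a facet of \<open>K\<close>: a kink.\<close>

subsection \<open>Rank-one maps\<close>

text \<open>Cramer's rule for the identity matrix: its rows are the unit vectors, and
  \<open>b\<close> is their combination with coefficients \<open>b $ i\<close>.\<close>

lemma det_mat_1_row:
  fixes b :: "real^'n"
  shows "det (\<chi> i. if i = k then b else axis i 1) = b $ k"
proof -
  have r: "row i (mat 1 :: real^'n^'n) = axis i 1" for i
    by (simp add: row_def mat_def axis_def vec_eq_iff eq_commute)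
  show ?thesis
    using cramer_lemma_transpose[of k b "mat 1 :: real^'n^'n"] unfolding r basis_expansion by simp
qed

text \<open>The matrix differs from the identity only in row \<open>k\<close>, where it has
  \<open>axis k 1 + c *s b\<close>; multilinearity in that row does the rest.\<close>

lemma det_rank_one_axis:
  fixes b :: "real^'n"
  shows "det (matrix (\<lambda>x. x + (b \<bullet> x) *\<^sub>R (c *\<^sub>R axis k (1::real)))) = 1 + c * (b $ k)"
proof -
  have "matrix (\<lambda>x. x + (b \<bullet> x) *\<^sub>R (c *\<^sub>R axis k (1::real)))
      = (\<chi> i. if i = k then axis i 1 + c *s b else axis i 1)"
    by (simp add: matrix_def vec_eq_iff inner_axis) (simp add: axis_def)
  also have "det \<dots> = det (\<chi> i. if i = k then axis i 1 else axis i 1 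
         :: real^'n^'n) + c * det (\<chi> i. if i = k then b else axis i 1)"
    by (simp only: det_row_add[of k "\<lambda>i. axis i 1" "\<lambda>i. c *s b" "\<lambda>i. axis i 1"]
      det_row_mul[of k c "\<lambda>i. b" "\<lambda>i. axis i 1"])
  \<comment> \<open>Row \<open>k\<close> is respelled so that \<open>det_mat_1_row\<close> also
    evaluates this determinant, with \<open>b = axis k 1\<close>.\<close>
  also have "(\<chi> i. if i = k then axis i 1 else axis i 1 :: real^'n^'n) = (\<chi> i. if i = k then axis k 1 else axis i 1)"
    by (simp add: vec_eq_iff)
  finally show ?thesis unfolding det_mat_1_row by simp
qed

lemma linear_rank_one: "linear (\<lambda>x. x + (a \<bullet> x) *\<^sub>R w)"
  by (auto intro!: linearI simp: algebra_simps)

text \<open>Matrix determinant lemma. An orthogonal \<open>T\<close> carries a multiple of a unit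
  vector to \<open>w\<close>, and conjugating by \<open>T\<close> reduces to the axis case.\<close>

lemma det_matrix_rank_one:
  fixes a w :: "real^'n"
  shows "det (matrix (\<lambda>x. x + (a \<bullet> x) *\<^sub>R w)) = 1 + a \<bullet> w"
proof -
  fix k :: 'n
  obtain T :: "real^'n \<Rightarrow> real^'n" where T: "orthogonal_transformation T" "T (norm w *\<^sub>R axis k 1) = w"
    by (rule orthogonal_transformation_exists[of "norm w *\<^sub>R axis k (1::real)" w]) auto
  define b where "b = adjoint T a"
  have lT: "linear T" using T by (simp add: orthogonal_transformation_linear)
  let ?g = "\<lambda>x. x + (b \<bullet> x) *\<^sub>R (norm w *\<^sub>R axis k (1::real))"
  let ?f = "\<lambda>x. x + (a \<bullet> x) *\<^sub>R w"
  have lg: "linear ?g" and lf: "linear ?f"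
    by (rule linear_rank_one)+
  have bx: "b \<bullet> x = a \<bullet> T x" for x
    unfolding b_def using adjoint_clauses[OF lT] by simp
  have "?f \<circ> T = T \<circ> ?g"
  proof (rule ext)
    fix x
    have "T (?g x) = T x + T ((b \<bullet> x) *\<^sub>R (norm w *\<^sub>R axis k 1))"
      by (rule linear_add[OF lT])
    also have "\<dots> = T x + (b \<bullet> x) *\<^sub>R T (norm w *\<^sub>R axis k 1)"
      by (subst linear_scale[OF lT, of "b \<bullet> x"]) (rule refl)
    finally show "(?f \<circ> T) x = (T \<circ> ?g) x" by (simp only: o_def T(2) bx)
  qed
  then have "matrix ?f ** matrix T = matrix T ** matrix ?g"
    using matrix_compose[OF lT lf] matrix_compose[OF lg lT] by simp
  then have "det (matrix ?f) * det (matrix T) = det (matrix T) * det (matrix ?g)"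
    unfolding det_mul[symmetric] by simp
  moreover have "det (matrix T) \<noteq> 0"
    using T(1) det_orthogonal_matrix[of "matrix T"] by (auto simp: orthogonal_transformation_matrix)
  ultimately have "det (matrix ?f) = det (matrix ?g)" by simp
  also have "\<dots> = 1 + norm w * (b $ k)" by (rule det_rank_one_axis)
  also have "norm w * (b $ k) = b \<bullet> (norm w *\<^sub>R axis k 1)" by (simp add: inner_axis)
  also have "\<dots> = a \<bullet> w" unfolding bx T(2) ..
  finally show ?thesis .
qed

text \<open>The library proves the determinant formula for linear images only for index types of class
  \<^class>\<open>wellorder\<close>; relabelling coordinates by a well-ordered copy of the index type removes that restriction.\<close>

typedef 'a wo = "UNIV :: 'a set" morphisms unwo wo by auto

lemma bij_unwo: "bij unwo"
  by (metis bijI' UNIV_I unwo_inject wo_inverse)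

instance wo :: (finite) finite
  by standard (metis bij_unwo bij_betw_finite finite)

instantiation wo :: (finite) wellorder
begin
definition less_eq_wo :: "'a wo \<Rightarrow> 'a wo \<Rightarrow> bool" where
  "less_eq_wo x y \<longleftrightarrow> to_nat (unwo x) \<le> to_nat (unwo y)"
definition less_wo :: "'a wo \<Rightarrow> 'a wo \<Rightarrow> bool" where
  "less_wo x y \<longleftrightarrow> to_nat (unwo x) < to_nat (unwo y)"
instance
proof
  fix P :: "'a wo \<Rightarrow> bool" and a
  assume H: "\<And>x. (\<And>y. y < x \<Longrightarrow> P y) \<Longrightarrow> P x"
  show "P a"
    by (induction "to_nat (unwo a)" arbitrary: a rule: less_induct) (auto intro: H simp: less_wo_def)
qed (auto simp: less_eq_wo_def less_wo_def unwo_inject)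
end

section \<open>Volume under relabelling of coordinates\<close>

definition vwo :: "real^'k \<Rightarrow> real^('k wo)" where
  "vwo x = (\<chi> i. x $ unwo i)"

definition unvwo :: "real^('k wo) \<Rightarrow> real^'k" where
  "unvwo x = (\<chi> i. x $ wo i)"

lemma vwo_inverse [simp]: "unvwo (vwo x) = x" "vwo (unvwo y) = y"
  by (simp_all add: vwo_def unvwo_def wo_inverse unwo_inverse)

lemma linear_vwo: "linear vwo" "linear unvwo"
  by (auto intro!: linearI simp: vwo_def unvwo_def vec_eq_iff)

lemma prod_Basis_vec: "(\<Prod>b\<in>Basis. (x :: real^'k::finite) \<bullet> b) = (\<Prod>i\<in>UNIV. x $ i)"
proof -
  have "bij_betw (\<lambda>i. axis i (1::real)) UNIV (Basis :: (real^'k) set)"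
    by (auto simp: bij_betw_def inj_on_def axis_eq_axis Basis_vec_def)
  from prod.reindex_bij_betw[OF this, of "\<lambda>b. x \<bullet> b"] show ?thesis by (simp add: inner_axis)
qed

text \<open>Boxes determine Lebesgue measure, and relabelling takes boxes to boxes with the same
  side lengths.\<close>

lemma lborel_unvwo: "distr lborel borel unvwo = (lborel :: (real^'k) measure)"
proof (rule lborel_eqI[symmetric])
  fix l u :: "real^'k" assume "\<And>b. b \<in> Basis \<Longrightarrow> l \<bullet> b \<le> u \<bullet> b"
  from this[of "axis _ 1"] have le: "l $ i \<le> u $ i" for i by (simp add: inner_axis axis_in_Basis_iff)
  have m: "(unvwo :: _ \<Rightarrow> real^'k) \<in> borel_measurable borel"
    using linear_vwo(2) by (intro borel_measurable_continuous_onI linear_continuous_on) (simp add: linear_conv_bounded_linear)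
  have "unvwo -` box l u = box (vwo l) (vwo u)"
  proof -
    have "(\<forall>i. P (wo i)) \<longleftrightarrow> (\<forall>i. P i)" for P by (metis unwo_inverse)
    from this[of "\<lambda>i. l $ unwo i < _ $ i \<and> _ $ i < u $ unwo i"] show ?thesis
      by (auto simp: mem_box_cart unvwo_def vwo_def wo_inverse) 
  qed
  then have "emeasure (distr lborel borel unvwo) (box l u) = emeasure lborel (box (vwo l) (vwo u))"
    using m by (simp add: emeasure_distr)
  also have "\<dots> = (\<Prod>b\<in>Basis. (vwo u - vwo l) \<bullet> b)"
  proof (rule emeasure_lborel_box)
    fix b :: "real^('k wo)" assume "b \<in> Basis"
    then show "vwo l \<bullet> b \<le> vwo u \<bullet> b" using le by (auto simp: Basis_vec_def inner_axis vwo_def)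
  qed
  also have "(\<Prod>b\<in>Basis. (vwo u - vwo l) \<bullet> b) = (\<Prod>i\<in>UNIV. (u - l) $ unwo i)"
    unfolding prod_Basis_vec by (simp add: vwo_def)
  also have "\<dots> = (\<Prod>i\<in>UNIV. (u - l) $ i)"
    using prod.reindex_bij_betw[OF bij_unwo, of "\<lambda>i. (u - l) $ i"] by simp
  finally show "emeasure (distr lborel borel unvwo) (box l u) = (\<Prod>b\<in>Basis. (u - l) \<bullet> b)"
    by (simp add: prod_Basis_vec)
qed simp

lemma measure_vwo:
  fixes S :: "(real^'k) set"
  assumes "compact S"
  shows "measure lebesgue (vwo ` S) = measure lebesgue S"
proof -
  have m: "unvwo \<in> borel_measurable borel"
    using linear_vwo(2) by (intro borel_measurable_continuous_onI linear_continuous_on) (simp add: linear_conv_bounded_linear)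
  have S: "S \<in> sets borel" using assms by (simp add: borel_compact)
  have "compact (vwo ` S)"
    using assms linear_vwo(1) by (intro compact_continuous_image linear_continuous_on) (auto simp: linear_conv_bounded_linear)
  then have S': "vwo ` S \<in> sets borel" by (simp add: borel_compact)
  have e: "unvwo -` S = vwo ` S" by (auto simp: image_iff) (metis vwo_inverse(2))
  have "measure lborel S = measure (distr lborel borel unvwo) S" by (simp add: lborel_unvwo)
  also have "\<dots> = measure lborel (vwo ` S)"
    using m S by (subst measure_distr) (auto simp: e)
  finally show ?thesis using S S' by simp
qed

text \<open>Relabelling preserves volumes and inner products, so it turns the map into a map of the
  same form on the relabelled space, where the determinant formula is available.\<close>

lemma measure_rank_one_image:
  fixes a w :: "real^'k"
  assumes "compact S"
  shows "measure lebesgue ((\<lambda>x. x + (a \<bullet> x) *\<^sub>R w) ` S) = \<bar>1 + a \<bullet> w\<bar> * measure lebesgue S"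
proof -
  let ?f = "\<lambda>x. x + (a \<bullet> x) *\<^sub>R w" and ?g = "\<lambda>x. x + (vwo a \<bullet> x) *\<^sub>R vwo w"
  have inn: "vwo x \<bullet> vwo y = x \<bullet> y" for x y :: "real^'k"
    using sum.reindex_bij_betw[OF bij_unwo, of "\<lambda>i. x $ i * y $ i"]
    by (simp add: inner_vec_def vwo_def)
  have lg: "linear ?g" and lf: "linear ?f"
    by (rule linear_rank_one)+
  have "compact (?f ` S)"
    using lf assms by (intro compact_continuous_image linear_continuous_on) (auto simp: linear_conv_bounded_linear)
  then have "measure lebesgue (?f ` S) = measure lebesgue (vwo ` ?f ` S)" by (simp add: measure_vwo)
  also have "vwo ` ?f ` S = ?g ` (vwo ` S)"
    using linear_vwo(1) by (simp add: image_image inn linear_add[OF linear_vwo(1)] linear_scale[OF linear_vwo(1)])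
  also have "measure lebesgue \<dots> = \<bar>det (matrix ?g)\<bar> * measure lebesgue (vwo ` S)"
  proof (rule measure_linear_image[OF lg])
    have "compact (vwo ` S)"
      using assms linear_vwo(1) by (intro compact_continuous_image linear_continuous_on) (auto simp: linear_conv_bounded_linear)
    then show "vwo ` S \<in> lmeasurable" by (rule lmeasurable_compact)
  qed
  finally show ?thesis using assms by (simp add: det_matrix_rank_one inn measure_vwo)
qed

subsection \<open>Volume of the hull of a polytope and a point\<close>

text \<open>The one-sided polar set. A polytope with 0 in its interior is the polar of its facet
  normals, scaled so that every facet hyperplane reads \<open>a \<bullet> x = 1\<close>.\<close>

definition polar :: "'a::euclidean_space set \<Rightarrow> 'a set" where
  "polar A = {x. \<forall>a\<in>A. a \<bullet> x \<le> 1}"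

text \<open>The reference pyramid with apex 0: moving the apex changes the volume only by a scalar
  factor.\<close>

definition facet_cone :: "'a::euclidean_space set \<Rightarrow> 'a \<Rightarrow> 'a set" where
  "facet_cone K a = convex hull (insert 0 (K \<inter> {x. a \<bullet> x = 1}))"

lemma mem_convex_hull_insert:
  assumes "convex K" "K \<noteq> {}"
  shows "x \<in> convex hull (insert w K) \<longleftrightarrow> (\<exists>u y. 0 \<le> u \<and> u \<le> 1 \<and> y \<in> K \<and> x = (1 - u) *\<^sub>R w + u *\<^sub>R y)"
  using assms by (auto simp: convex_hull_insert_alt hull_same)

text \<open>The affine map \<open>x \<mapsto> w + x - (a \<bullet> x) *\<^sub>R w\<close> sends 0 to
  \<open>w\<close>, fixes the hyperplane of \<open>G\<close> pointwise and has determinant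
  \<open>1 - a \<bullet> w\<close>.\<close>

lemma measure_pyramid:
  fixes G :: "(real^'k) set"
  assumes "compact G" "G \<subseteq> {x. a \<bullet> x = 1}"
  shows "measure lebesgue (convex hull (insert w G)) = \<bar>a \<bullet> w - 1\<bar> * measure lebesgue (convex hull (insert 0 G))"
proof -
  let ?f = "\<lambda>x. x + (- a \<bullet> x) *\<^sub>R w"
  have lf: "linear ?f" by (rule linear_rank_one)
  have "(+) w ` ?f ` insert 0 G = insert w G"
  proof -
    have "w + ?f x = x" if "x \<in> G" for x using that assms(2) by auto
    then have "(\<lambda>x. w + ?f x) ` G = (\<lambda>x. x) ` G" by (intro image_cong refl)
    then show ?thesis by (simp add: image_image)
  qed
  then have "convex hull (insert w G) = (+) w ` ?f ` (convex hull (insert 0 G))"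
    by (simp only: convex_hull_linear_image[OF lf] flip: convex_hull_translation)
  then have "measure lebesgue (convex hull (insert w G)) = measure lebesgue (?f ` (convex hull (insert 0 G)))"
    by (simp add: measure_translation)
  also have "\<dots> = \<bar>1 + - a \<bullet> w\<bar> * measure lebesgue (convex hull (insert 0 G))"
    using assms(1) by (intro measure_rank_one_image compact_convex_hull) simp
  finally show ?thesis by (simp add: abs_minus_commute)
qed

lemma convex_polar: "convex (polar A)"
  unfolding polar_def by (auto simp: convex_def inner_add_right intro: convex_bound_le)

lemma zero_mem_polar [simp]: "0 \<in> polar A"
  by (simp add: polar_def)

text \<open>The segment from \<open>w\<close> into \<open>polar A\<close> enters through a facet that is visible from \<open>w\<close>; minimising
  the entry parameter \<open>r\<close> over the visible constraints finds it.\<close>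

lemma convex_hull_insert_polar_cases:
  assumes "finite A" "x \<in> convex hull (insert w (polar A))" "x \<notin> polar A"
  obtains a where "a \<in> A" "1 < a \<bullet> w" "x \<in> convex hull (insert w (polar A \<inter> {x. a \<bullet> x = 1}))"
proof -
  have ne: "polar A \<noteq> {}" using zero_mem_polar by blast
  obtain u y where u: "0 \<le> u" "u \<le> 1" and y: "y \<in> polar A" and x: "x = (1 - u) *\<^sub>R w + u *\<^sub>R y"
    using assms(2) mem_convex_hull_insert[OF convex_polar ne] by metis
  let ?V = "{a \<in> A. 1 < a \<bullet> w}"
  have ay: "a \<bullet> y \<le> 1" if "a \<in> A" for a using y that by (auto simp: polar_def)
  obtain a0 where a0: "a0 \<in> A" "a0 \<bullet> x > 1" using assms(3) by (auto simp: polar_def not_le)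
  have "?V \<noteq> {}"
  proof -
    have "a0 \<bullet> w > 1"
    proof (rule ccontr)
      assume "\<not> a0 \<bullet> w > 1"
      then have "a0 \<bullet> x \<le> 1"
        unfolding x inner_add_right inner_scaleR_right using ay[OF a0(1)] u
        by (intro convex_bound_le) auto
      with a0 show False by simp
    qed
    with a0 show ?thesis by auto
  qed
  \<comment> \<open>The point \<open>(1 - r a) *\<^sub>R y + r a *\<^sub>R w\<close> of the segment
    from \<open>y\<close> to \<open>w\<close> lies in the hyperplane of \<open>a\<close>.\<close>
  define r where "r a = (1 - a \<bullet> y) / (a \<bullet> w - a \<bullet> y)" for a
  obtain a where a: "a \<in> A" "1 < a \<bullet> w" and amin: "\<And>b. b \<in> A \<Longrightarrow> 1 < b \<bullet> w \<Longrightarrow> r a \<le> r b"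
  proof -
    have f: "finite (r ` ?V)" using assms(1) by auto
    then have "Min (r ` ?V) \<in> r ` ?V" using \<open>?V \<noteq> {}\<close> by (intro Min_in) auto
    then obtain a where a: "a \<in> ?V" "r a = Min (r ` ?V)" by auto
    have "r a \<le> r b" if "b \<in> A" "1 < b \<bullet> w" for b
      unfolding a(2) using f that by (intro Min_le) auto
    with a show thesis using that by blast
  qed
  have r01: "0 \<le> r b" "r b < 1" if "b \<in> A" "1 < b \<bullet> w" for b
    using ay[OF that(1)] that(2) by (auto simp: r_def divide_simps)
  define z where "z = (1 - r a) *\<^sub>R y + r a *\<^sub>R w"
  have bz: "b \<bullet> z = b \<bullet> y + r a * (b \<bullet> w - b \<bullet> y)" for b
    by (simp add: z_def inner_add_right algebra_simps)
  have az: "a \<bullet> z = 1" unfolding bz using ay[OF a(1)] a(2) by (simp add: r_def)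
  have zK: "z \<in> polar A"
    unfolding polar_def
  proof (clarify)
    fix b assume b: "b \<in> A"
    show "b \<bullet> z \<le> 1"
    proof (cases "1 < b \<bullet> w")
      case True
      have "r a * (b \<bullet> w - b \<bullet> y) \<le> r b * (b \<bullet> w - b \<bullet> y)"
        using amin[OF b True] ay[OF b] True by (intro mult_right_mono) auto
      also have "\<dots> = 1 - b \<bullet> y" using ay[OF b] True by (simp add: r_def)
      finally show ?thesis by (simp add: bz)
    next
      case False
      show ?thesis unfolding z_def inner_add_right inner_scaleR_right
        using False ay[OF b] r01[OF a] by (intro convex_bound_le) auto
    qed
  qed
  \<comment> \<open>On the segment from \<open>y\<close> to \<open>w\<close>, \<open>x\<close> has
    parameter \<open>1 - u\<close>. With a parameter of at most \<open>r a\<close> it would lie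
    between \<open>y\<close> and \<open>z\<close>, hence in \<open>polar A\<close>.\<close>
  have lt: "r a < 1 - u"
  proof (rule ccontr)
    assume "\<not> r a < 1 - u"
    then have *: "1 - u \<le> r a" by simp
    have "a0 \<bullet> x = (1 - u) * (a0 \<bullet> w - a0 \<bullet> y) + a0 \<bullet> y"
      by (simp add: x inner_add_right algebra_simps)
    also have "\<dots> \<le> 1"
    proof (cases "a0 \<bullet> w \<ge> a0 \<bullet> y")
      case True
      then have "(1 - u) * (a0 \<bullet> w - a0 \<bullet> y) \<le> r a * (a0 \<bullet> w - a0 \<bullet> y)"
        using * by (intro mult_right_mono) auto
      moreover have "a0 \<bullet> z \<le> 1" using zK a0 by (auto simp: polar_def)
      ultimately show ?thesis unfolding bz by simp
    next
      case False
      then have "(1 - u) * (a0 \<bullet> w - a0 \<bullet> y) \<le> 0" using u by (simp add: mult_le_0_iff)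
      then show ?thesis using ay[OF a0(1)] by simp
    qed
    finally show False using a0 by simp
  qed
  \<comment> \<open>The position of \<open>x\<close> between \<open>w\<close> and \<open>z\<close>,
    found by comparing coefficients of \<open>y\<close>.\<close>
  define s where "s = u / (1 - r a)"
  have s: "0 \<le> s" "s \<le> 1" "s * (1 - r a) = u" using lt u r01[OF a] by (auto simp: s_def divide_simps)
  have "x = (1 - s) *\<^sub>R w + s *\<^sub>R z"
  proof -
    have "(1 - s) *\<^sub>R w + s *\<^sub>R z = (1 - s + s * r a) *\<^sub>R w + (s * (1 - r a)) *\<^sub>R y"
      by (simp add: z_def algebra_simps)
    also have "1 - s + s * r a = 1 - s * (1 - r a)" by (simp add: algebra_simps)
    finally show ?thesis by (simp add: s x)
  qed
  moreover have "z \<in> convex hull (insert w (polar A \<inter> {x. a \<bullet> x = 1}))"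
    using zK az by (intro hull_inc) auto
  moreover have "w \<in> convex hull (insert w (polar A \<inter> {x. a \<bullet> x = 1}))"
    by (intro hull_inc) auto
  ultimately have "x \<in> convex hull (insert w (polar A \<inter> {x. a \<bullet> x = 1}))"
    using s by (auto intro!: convexD[OF convex_convex_hull])
  with a show thesis using that by blast
qed

lemma closed_polar: "closed (polar A)"
proof -
  have "polar A = (\<Inter>a\<in>A. {x. a \<bullet> x \<le> 1})" by (auto simp: polar_def)
  then show ?thesis by (auto intro: closed_halfspace_le)
qed

lemma compact_polar: "bounded (polar A) \<Longrightarrow> compact (polar A)"
  by (simp add: closed_polar compact_eq_bounded_closed)

lemma negligible_pyramid_Int:
  fixes a b w :: "'a::euclidean_space"
  assumes "1 < a \<bullet> w" "1 < b \<bullet> w" "a \<noteq> b" "a \<in> A" "b \<in> A"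
  shows "negligible (convex hull (insert w (polar A \<inter> {x. a \<bullet> x = 1})) \<inter> convex hull (insert w (polar A \<inter> {x. b \<bullet> x = 1})))"
proof -
  \<comment> \<open>On the pyramid over facet \<open>a\<close> with apex \<open>w\<close>, the affine functions \<open>(c \<bullet> x - 1) / (c \<bullet> w - 1)\<close>,
    normalised to be 1 at \<open>w\<close>, are maximal for \<open>c = a\<close>.\<close>
  have key: "(b \<bullet> x - 1) * (a \<bullet> w - 1) \<le> (a \<bullet> x - 1) * (b \<bullet> w - 1)"
    if x: "x \<in> convex hull (insert w (polar A \<inter> {x. a \<bullet> x = 1}))" and ab: "1 < a \<bullet> w" "1 < b \<bullet> w" "b \<in> A" for a b x
  proof -
    have "insert w (polar A \<inter> {x. a \<bullet> x = 1}) \<subseteq> {x. ((a \<bullet> w - 1) *\<^sub>R b - (b \<bullet> w - 1) *\<^sub>R a) \<bullet> x \<le> (a \<bullet> w - 1) - (b \<bullet> w - 1)}"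
    proof -
      have "(a \<bullet> w - 1) * (b \<bullet> y) \<le> (a \<bullet> w - 1) * 1" if "y \<in> polar A" "a \<bullet> y = 1" for y
        using ab that by (intro mult_left_mono) (auto simp: polar_def)
      then show ?thesis by (auto simp: inner_diff_left algebra_simps)
    qed
    then have "x \<in> {x. ((a \<bullet> w - 1) *\<^sub>R b - (b \<bullet> w - 1) *\<^sub>R a) \<bullet> x \<le> (a \<bullet> w - 1) - (b \<bullet> w - 1)}"
      using x hull_minimal[where S = convex, OF _ convex_halfspace_le] by blast
    then show ?thesis by (simp add: inner_diff_left algebra_simps)
  qed
  \<comment> \<open>On the intersection both normalised functions agree. This confines it to a
    genuine hyperplane: if \<open>?c\<close> vanished, evaluation at \<open>w\<close> would give
    \<open>a \<bullet> w = b \<bullet> w\<close> and then \<open>a = b\<close>.\<close>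
  let ?c = "(a \<bullet> w - 1) *\<^sub>R b - (b \<bullet> w - 1) *\<^sub>R a"
  have "?c \<noteq> 0"
  proof
    assume c: "?c = 0"
    then have "?c \<bullet> w = 0" by simp
    then have "a \<bullet> w = b \<bullet> w" by (simp add: inner_diff_left algebra_simps)
    with c assms show False by (auto simp flip: scaleR_diff_right)
  qed
  then have "negligible {x. ?c \<bullet> x = (a \<bullet> w - 1) - (b \<bullet> w - 1)}"
    by (rule negligible_hyperplane[OF disjI1])
  then show ?thesis
  proof (rule negligible_subset, intro subsetI)
    fix x assume "x \<in> convex hull (insert w (polar A \<inter> {x. a \<bullet> x = 1})) \<inter> convex hull (insert w (polar A \<inter> {x. b \<bullet> x = 1}))"
    then show "x \<in> {x. ?c \<bullet> x = (a \<bullet> w - 1) - (b \<bullet> w - 1)}"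
      using key[of x a b] key[of x b a] assms by (simp add: inner_diff_left algebra_simps)
  qed
qed

lemma measure_Un_negligible:
  assumes "S \<in> lmeasurable" "T \<in> lmeasurable" "negligible (S \<inter> T)"
  shows "measure lebesgue (S \<union> T) = measure lebesgue S + measure lebesgue T"
  using measure_Un3[OF assms(1,2)] negligible_imp_measure0[OF assms(3)] by simp

text \<open>The hull splits into \<open>polar A\<close> and the pyramids over the constraints
  visible from \<open>w\<close>, overlapping only in null sets. The maximum with 0 discards the
  invisible constraints.\<close>

lemma measure_convex_hull_insert_polar:
  fixes A :: "(real^'k) set"
  assumes "finite A" "bounded (polar A)"
  shows "measure lebesgue (convex hull (insert w (polar A)))
       = measure lebesgue (polar A) + (\<Sum>a\<in>A. max 0 (a \<bullet> w - 1) * measure lebesgue (facet_cone (polar A) a))"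
proof -
  let ?V = "{a \<in> A. 1 < a \<bullet> w}"
  let ?D = "\<lambda>a. convex hull (insert w (polar A \<inter> {x. a \<bullet> x = 1}))"
  have cK: "compact (polar A)" by (rule compact_polar) fact
  then have cG: "compact (polar A \<inter> {x. a \<bullet> x = 1})" for a
    by (intro compact_Int_closed closed_hyperplane)
  have mK: "polar A \<in> lmeasurable" using cK by (rule lmeasurable_compact)
  have mD: "?D a \<in> lmeasurable" for a
    using cG by (simp add: compact_convex_hull lmeasurable_compact)
  have hull: "convex hull (insert w (polar A)) = polar A \<union> (\<Union>a\<in>?V. ?D a)"
  proof
    show "convex hull (insert w (polar A)) \<subseteq> polar A \<union> (\<Union>a\<in>?V. ?D a)"
    proof
      fix x assume "x \<in> convex hull (insert w (polar A))"
      then show "x \<in> polar A \<union> (\<Union>a\<in>?V. ?D a)"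
        by (cases "x \<in> polar A") (auto elim: convex_hull_insert_polar_cases[OF assms(1)])
    qed
    have "?D a \<subseteq> convex hull (insert w (polar A))" for a by (rule hull_mono) auto
    then show "polar A \<union> (\<Union>a\<in>?V. ?D a) \<subseteq> convex hull (insert w (polar A))"
      by (auto intro: hull_inc)
  qed
  have neg: "negligible (polar A \<inter> (\<Union>a\<in>?V. ?D a))"
  proof -
    have "negligible (polar A \<inter> ?D a)" if a: "a \<in> ?V" for a
    proof -
      have "insert w (polar A \<inter> {x. a \<bullet> x = 1}) \<subseteq> {x. a \<bullet> x \<ge> 1}" using a by auto
      then have "?D a \<subseteq> {x. a \<bullet> x \<ge> 1}" by (rule hull_minimal) (rule convex_halfspace_ge)
      then have "polar A \<inter> ?D a \<subseteq> {x. a \<bullet> x = 1}" using a by (force simp: polar_def)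
      moreover have "negligible {x. a \<bullet> x = 1}" by (rule negligible_hyperplane) simp
      ultimately show ?thesis by (rule negligible_subset[rotated])
    qed
    then have "negligible (\<Union>a\<in>?V. polar A \<inter> ?D a)" using assms(1) by (intro negligible_Union) auto
    then show ?thesis unfolding Int_UN_distrib .
  qed
  have "(\<Union>a\<in>?V. ?D a) \<in> lmeasurable"
    using assms(1) mD by (intro fmeasurable.finite_UN) auto
  then have "measure lebesgue (convex hull (insert w (polar A))) = measure lebesgue (polar A) + measure lebesgue (\<Union>a\<in>?V. ?D a)"
    unfolding hull by (rule measure_Un_negligible[OF mK _ neg])
  also have "measure lebesgue (\<Union>a\<in>?V. ?D a) = (\<Sum>a\<in>?V. measure lebesgue (?D a))"
  proof (rule measure_negligible_finite_Union_image[OF _ mD])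
    show "finite ?V" using assms(1) by simp
    show "pairwise (\<lambda>a b. negligible (?D a \<inter> ?D b)) ?V"
      by (rule pairwiseI) (rule negligible_pyramid_Int, blast+)
  qed
  also have "\<dots> = (\<Sum>a\<in>?V. max 0 (a \<bullet> w - 1) * measure lebesgue (facet_cone (polar A) a))"
    by (intro sum.cong refl) (subst measure_pyramid[OF cG], auto simp: facet_cone_def)
  also have "\<dots> = (\<Sum>a\<in>A. max 0 (a \<bullet> w - 1) * measure lebesgue (facet_cone (polar A) a))"
    using assms(1) by (intro sum.mono_neutral_left) auto
  finally show ?thesis .
qed

section \<open>Adjoining a pair of opposite points\<close>

lemma in_convex3:
  assumes "convex K" "x \<in> K" "y \<in> K" "z \<in> K" "0 \<le> a" "0 \<le> b" "0 \<le> c" "a + b + c = (1::real)"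
  shows "a *\<^sub>R x + b *\<^sub>R y + c *\<^sub>R z \<in> K"
  using assms convex_hull_3[of x y z] hull_minimal[of "{x,y,z}" K convex] by blast

text \<open>Opposite weights on \<open>w\<close> and \<open>- w\<close> cancel, and the freed weight
  can be put on \<open>0 \<in> K\<close>; so one of the two points always suffices.\<close>

lemma convex_hull_insert_opposite:
  fixes K :: "'a::real_vector set"
  assumes K: "convex K" "0 \<in> K"
  shows "convex hull (insert w (insert (- w) K)) = convex hull (insert w K) \<union> convex hull (insert (- w) K)"
    and "convex hull (insert w K) \<inter> convex hull (insert (- w) K) = K"
proof -
  have ne: "K \<noteq> {}" using K by auto
  note mem = mem_convex_hull_insert[OF K(1) ne]
  show "convex hull (insert w K) \<inter> convex hull (insert (- w) K) = K"
  proof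
    show "K \<subseteq> convex hull (insert w K) \<inter> convex hull (insert (- w) K)"
      by (auto intro: hull_inc)
    show "convex hull (insert w K) \<inter> convex hull (insert (- w) K) \<subseteq> K"
    proof
      fix x assume "x \<in> convex hull (insert w K) \<inter> convex hull (insert (- w) K)"
      then obtain u y s z where u: "0 \<le> u" "u \<le> 1" and y: "y \<in> K" and xu: "x = (1 - u) *\<^sub>R w + u *\<^sub>R y"
        and s: "0 \<le> s" "s \<le> 1" and z: "z \<in> K" and xs: "x = (1 - s) *\<^sub>R (- w) + s *\<^sub>R z"
        unfolding Int_iff mem by blast
      \<comment> \<open>Weighting the two representations of \<open>x\<close> by
        \<open>1 - s\<close> and \<open>1 - u\<close> and adding eliminates \<open>w\<close>. The
        total weight \<open>p\<close> vanishes only if \<open>x = y = z\<close>.\<close>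
      define p where "p = (1 - u) + (1 - s)"
      show "x \<in> K"
      proof (cases "p = 0")
        case True
        then have "u = 1" using u s by (simp add: p_def)
        then show ?thesis using xu y by simp
      next
        case False
        then have p: "p > 0" using u s by (auto simp: p_def)
        have "p *\<^sub>R x = (1 - s) *\<^sub>R x + (1 - u) *\<^sub>R x"
          by (simp add: p_def add.commute flip: scaleR_left_distrib)
        also have "\<dots> = ((1 - s) * u) *\<^sub>R y + ((1 - u) * s) *\<^sub>R z"
          by (subst xu, subst xs) (simp add: algebra_simps)
        finally have px: "p *\<^sub>R x = ((1 - s) * u) *\<^sub>R y + ((1 - u) * s) *\<^sub>R z" .
        have "x = (1 / p) *\<^sub>R (p *\<^sub>R x)" using p by simp
        then have x: "x = ((1 - s) * u / p) *\<^sub>R y + ((1 - u) * s / p) *\<^sub>R z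
            + (1 - (1 - s) * u / p - (1 - u) * s / p) *\<^sub>R 0"
          unfolding px by (simp add: scaleR_add_right)
        have "(1 - s) * u + (1 - u) * s \<le> (1 - s) * 1 + (1 - u) * 1"
          using u s by (intro add_mono mult_left_mono) auto
        then have "((1 - s) * u + (1 - u) * s) / p \<le> 1" using p by (simp add: p_def)
        then have "(1 - s) * u / p + (1 - u) * s / p \<le> 1" by (simp add: add_divide_distrib)
        moreover have "0 \<le> (1 - s) * u / p" "0 \<le> (1 - u) * s / p" using u s p by simp_all
        ultimately show ?thesis
          by (subst x) (rule in_convex3[OF K(1) y z K(2)], linarith+)
      qed
    qed
  qed
  show "convex hull (insert w (insert (- w) K)) = convex hull (insert w K) \<union> convex hull (insert (- w) K)"
  proof
    show "convex hull (insert w K) \<union> convex hull (insert (- w) K) \<subseteq> convex hull (insert w (insert (- w) K))"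
      by (intro Un_least hull_mono) auto
    show "convex hull (insert w (insert (- w) K)) \<subseteq> convex hull (insert w K) \<union> convex hull (insert (- w) K)"
    proof
      fix x assume "x \<in> convex hull (insert w (insert (- w) K))"
      then obtain u y s z where u: "0 \<le> u" "u \<le> 1" and x: "x = (1 - u) *\<^sub>R w + u *\<^sub>R y"
        and s: "0 \<le> s" "s \<le> 1" and z: "z \<in> K" and y: "y = (1 - s) *\<^sub>R (- w) + s *\<^sub>R z"
        unfolding convex_hull_insert_alt[of w] using ne by (auto simp: mem)
      \<comment> \<open>The net weight of \<open>w\<close>; its sign decides which of the two hulls
        contains \<open>x\<close>.\<close>
      define q where "q = (1 - u) - u * (1 - s)"
      have xq: "x = q *\<^sub>R w + (u * s) *\<^sub>R z" 
        by (simp add: x y q_def scaleR_left_diff_distrib[of "1 - u" "u * (1 - s)"] scaleR_add_right scaleR_diff_right)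
      have us: "0 \<le> u * s" "u * s \<le> 1 - \<bar>q\<bar>"
      proof -
        show "0 \<le> u * s" using u s by simp
        have "u * (1 - s) \<ge> 0" using u s by simp
        then show "u * s \<le> 1 - \<bar>q\<bar>" using u by (simp add: q_def abs_if algebra_simps)
      qed
      have "\<exists>y\<in>K. (u * s) *\<^sub>R z = (1 - \<bar>q\<bar>) *\<^sub>R y"
      proof (cases "\<bar>q\<bar> = 1")
        case True
        then have "u * s = 0" using us by simp
        then show ?thesis using True K by (intro bexI[of _ 0]) simp_all
      next
        case False
        then have q: "1 - \<bar>q\<bar> > 0" using us by linarith
        let ?r = "u * s / (1 - \<bar>q\<bar>)"
        have "?r *\<^sub>R z + (1 - ?r) *\<^sub>R 0 \<in> K" using K z us q by (intro convexD) auto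
        then show ?thesis using q by (intro bexI[of _ "?r *\<^sub>R z"]) auto
      qed
      then obtain y' where y': "y' \<in> K" "(u * s) *\<^sub>R z = (1 - \<bar>q\<bar>) *\<^sub>R y'" by blast
      have "x \<in> convex hull (insert w K)" if "q \<ge> 0"
        unfolding mem using that us y' xq by (intro exI[of _ "1 - q"] exI[of _ y']) auto
      moreover have "x \<in> convex hull (insert (- w) K)" if "q < 0"
        unfolding mem using that us y' xq by (intro exI[of _ "1 + q"] exI[of _ y']) auto
      ultimately show "x \<in> convex hull (insert w K) \<union> convex hull (insert (- w) K)" by fastforce
    qed
  qed
qed

text \<open>Inclusion-exclusion for the two hulls, which meet in \<open>polar A\<close>. For each
  \<open>a\<close> at most one of \<open>a \<bullet> w\<close> and \<open>a \<bullet> (- w)\<close>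
  exceeds 1, so the two terms merge into one with an absolute value.\<close>

lemma measure_convex_hull_insert_opposite_polar:
  fixes A :: "(real^'k) set"
  assumes "finite A" "bounded (polar A)"
  shows "measure lebesgue (convex hull (insert w (insert (- w) (polar A))))
       = measure lebesgue (polar A) + (\<Sum>a\<in>A. max 0 (\<bar>a \<bullet> w\<bar> - 1) * measure lebesgue (facet_cone (polar A) a))"
proof -
  have cK: "compact (polar A)" by (rule compact_polar) fact
  have m: "convex hull (insert w (polar A)) \<in> lmeasurable" for w
    using cK by (simp add: compact_convex_hull lmeasurable_compact)
  have mx: "max 0 (a \<bullet> w - 1) + max 0 (a \<bullet> (- w) - 1) = max 0 (\<bar>a \<bullet> w\<bar> - 1)" for a
    by (auto simp: max_def abs_if)
  let ?c = "\<lambda>a. measure lebesgue (facet_cone (polar A) a)"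
  let ?U = "convex hull (insert w (polar A))" and ?U' = "convex hull (insert (- w) (polar A))"
  have "measure lebesgue (?U \<union> ?U') = measure lebesgue ?U + measure lebesgue ?U' - measure lebesgue (?U \<inter> ?U')"
    by (rule measure_Un3) (rule m)+
  also have "?U \<inter> ?U' = polar A" by (rule convex_hull_insert_opposite[OF convex_polar zero_mem_polar])
  also have "measure lebesgue ?U + measure lebesgue ?U' - measure lebesgue (polar A)
      = measure lebesgue (polar A) + ((\<Sum>a\<in>A. max 0 (a \<bullet> w - 1) * ?c a) + (\<Sum>a\<in>A. max 0 (a \<bullet> (- w) - 1) * ?c a))"
    unfolding measure_convex_hull_insert_polar[OF assms] by linarith
  also have "(\<Sum>a\<in>A. max 0 (a \<bullet> w - 1) * ?c a) + (\<Sum>a\<in>A. max 0 (a \<bullet> (- w) - 1) * ?c a)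
      = (\<Sum>a\<in>A. max 0 (\<bar>a \<bullet> w\<bar> - 1) * ?c a)"
    unfolding sum.distrib[symmetric] distrib_right[symmetric] mx ..
  finally show ?thesis
    unfolding convex_hull_insert_opposite(1)[OF convex_polar zero_mem_polar] .
qed

text \<open>On the cone over the face of \<open>a\<close> the form \<open>a\<close> is the largest
  of all forms in \<open>A\<close>, so two cones meet inside the hyperplane where their forms
  agree.\<close>

lemma measure_UN_facet_cone:
  fixes A :: "(real^'k) set"
  assumes "finite B" "B \<subseteq> A" "bounded (polar A)"
  shows "measure lebesgue (\<Union>a\<in>B. facet_cone (polar A) a) = (\<Sum>a\<in>B. measure lebesgue (facet_cone (polar A) a))"
proof (rule measure_negligible_finite_Union_image[OF assms(1)])
  have cK: "compact (polar A)" by (rule compact_polar) fact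
  then show "facet_cone (polar A) a \<in> lmeasurable" for a
    unfolding facet_cone_def
    by (intro lmeasurable_compact compact_convex_hull compact_insert compact_Int_closed closed_hyperplane)
  have le: "b \<bullet> x \<le> a \<bullet> x" if "a \<in> A" "b \<in> A" "x \<in> facet_cone (polar A) a" for a b x
  proof -
    have "insert 0 (polar A \<inter> {x. a \<bullet> x = 1}) \<subseteq> {x. (b - a) \<bullet> x \<le> 0}"
      using that by (auto simp: polar_def inner_diff_left)
    then have "facet_cone (polar A) a \<subseteq> {x. (b - a) \<bullet> x \<le> 0}"
      unfolding facet_cone_def by (rule hull_minimal) (rule convex_halfspace_le)
    then show ?thesis using that by (auto simp: inner_diff_left)
  qed
  show "pairwise (\<lambda>a b. negligible (facet_cone (polar A) a \<inter> facet_cone (polar A) b)) B"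
  proof (rule pairwiseI)
    fix a b assume ab: "a \<in> B" "b \<in> B" "a \<noteq> b"
    then have "negligible {x. (b - a) \<bullet> x = 0}" by (intro negligible_hyperplane) simp
    then show "negligible (facet_cone (polar A) a \<inter> facet_cone (polar A) b)"
    proof (rule negligible_subset, intro subsetI)
      fix x assume "x \<in> facet_cone (polar A) a \<inter> facet_cone (polar A) b"
      then have "b \<bullet> x = a \<bullet> x" using le[of a b x] le[of b a x] subsetD[OF assms(2) ab(1)] subsetD[OF assms(2) ab(2)] by simp
      then show "x \<in> {x. (b - a) \<bullet> x = 0}" by (simp add: inner_diff_left)
    qed
  qed
qed

subsection \<open>Stretching a pair of opposite points\<close>

text \<open>As 0 is interior, every bounding inequality has a positive right-hand side and can be
  scaled to \<open>a \<bullet> x \<le> 1\<close>. Minimality of the system of half-spaces makes each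
  constraint a facet.\<close>

lemma polytope_eq_polar:
  fixes P :: "'a::euclidean_space set"
  assumes "polytope P" "0 \<in> interior P"
  obtains A where "finite A" "P = polar A" "\<And>F. F facet_of P \<longleftrightarrow> (\<exists>a\<in>A. F = P \<inter> {x. a \<bullet> x = 1})"
proof -
  have aff: "affine hull P = UNIV"
    using assms(2) by (intro affine_hull_nonempty_interior) auto
  obtain H where H: "finite H" "P = affine hull P \<inter> \<Inter>H"
      "\<And>h. h \<in> H \<Longrightarrow> \<exists>a b. a \<noteq> 0 \<and> h = {x. a \<bullet> x \<le> b}"
      "\<And>H'. H' \<subset> H \<Longrightarrow> P \<subset> affine hull P \<inter> \<Inter>H'"
    using polytope_imp_polyhedron[OF assms(1)] unfolding polyhedron_Int_affine_minimal by meson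
  from H(3) obtain a b where ab: "\<And>h. h \<in> H \<Longrightarrow> a h \<noteq> 0 \<and> h = {x. a h \<bullet> x \<le> b h}"
    by metis
  have b: "b h > 0" if "h \<in> H" for h
  proof -
    have "P \<subseteq> h" using H(2) that by blast
    then have "0 \<in> interior h" using assms(2) interior_mono[of P h] by auto
    moreover have "interior h = {x. a h \<bullet> x < b h}"
      using ab[OF that] by (metis interior_halfspace_le)
    ultimately show ?thesis by simp
  qed
  define n where "n h = a h /\<^sub>R b h" for h
  have n: "n h \<bullet> x \<le> 1 \<longleftrightarrow> a h \<bullet> x \<le> b h" "n h \<bullet> x = 1 \<longleftrightarrow> a h \<bullet> x = b h" if "h \<in> H" for h x
    using b[OF that] by (auto simp: n_def field_simps)
  show thesis
  proof (rule that[of "n ` H"])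
    show "finite (n ` H)" using H(1) by simp
    have "x \<in> P \<longleftrightarrow> (\<forall>h\<in>H. a h \<bullet> x \<le> b h)" for x
      using H(2) ab unfolding aff by blast
    then show "P = polar (n ` H)" by (auto simp: polar_def n)
    show "F facet_of P \<longleftrightarrow> (\<exists>a\<in>n ` H. F = P \<inter> {x. a \<bullet> x = 1})" for F
      using facet_of_polyhedron_explicit[OF H(1,2) ab H(4), of F] by (auto simp: n)
  qed
qed

section \<open>Cones over facets and stars\<close>

lemma measure_pos_aff_dim_full:
  fixes S :: "'a::euclidean_space set"
  assumes "convex S" "S \<in> lmeasurable" "aff_dim S = DIM('a)"
  shows "measure lebesgue S > 0"
proof -
  have "S \<noteq> {}" using assms(3) by auto
  then have "interior S \<noteq> {}"
    using assms by (simp add: interior_rel_interior_gen rel_interior_eq_empty)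
  then have "\<not> negligible S" using assms(1) by (simp add: negligible_convex_interior)
  then have "measure lebesgue S \<noteq> 0" using assms(2) by (simp add: negligible_iff_measure)
  then show ?thesis by (simp add: zero_less_measure_iff)
qed

lemma zero_notin_affine_hull:
  assumes "F \<subseteq> {x. a \<bullet> x = (1::real)}"
  shows "0 \<notin> affine hull F"
proof -
  have "affine hull F \<subseteq> {x. a \<bullet> x = 1}"
    using assms affine_hyperplane by (rule hull_minimal)
  then show ?thesis by auto
qed

text \<open>The apex 0 lies off the hyperplane of the facet, so it raises the dimension by one and
  makes the cone full-dimensional.\<close>

lemma measure_facet_cone_pos:
  fixes P :: "'a::euclidean_space set"
  assumes P: "compact P" "aff_dim P = DIM('a)" and F: "(P \<inter> {x. a \<bullet> x = 1}) facet_of P"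
  shows "measure lebesgue (facet_cone P a) > 0"
proof (rule measure_pos_aff_dim_full)
  let ?F = "P \<inter> {x. a \<bullet> x = 1}"
  show "convex (facet_cone P a)" by (simp add: facet_cone_def)
  show "facet_cone P a \<in> lmeasurable"
    unfolding facet_cone_def using P
    by (intro lmeasurable_compact compact_convex_hull compact_insert compact_Int_closed closed_hyperplane)
  have "0 \<notin> affine hull ?F" by (rule zero_notin_affine_hull[of _ a]) auto
  then have "aff_dim (insert 0 ?F) = aff_dim ?F + 1" by (simp add: aff_dim_insert)
  also have "aff_dim ?F = DIM('a) - 1" using F P by (simp add: facet_of_def)
  finally show "aff_dim (facet_cone P a) = DIM('a)"
    by (simp add: facet_cone_def aff_dim_convex_hull)
qed

lemma star_eq_UN_facet_cone:
  fixes P :: "'a::euclidean_space set"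
  assumes "\<And>F. F facet_of P \<longleftrightarrow> (\<exists>a\<in>A. F = P \<inter> {x. a \<bullet> x = 1})" "v \<in> P" "- v \<in> P"
  shows "star P v = (\<Union>a\<in>{a \<in> A. \<bar>a \<bullet> v\<bar> = 1}. facet_cone P a)"
proof -
  let ?G = "\<lambda>a. P \<inter> {x. a \<bullet> x = 1}"
  have G: "\<bar>a \<bullet> v\<bar> = 1 \<longleftrightarrow> v \<in> ?G a \<or> - v \<in> ?G a" for a
    using assms(2,3) by (auto simp: abs_if)
  have "{convex hull (F \<union> {0}) | F. F facet_of P \<and> (v \<in> F \<or> - v \<in> F)}
      = (\<lambda>a. convex hull (?G a \<union> {0})) ` {a \<in> A. \<bar>a \<bullet> v\<bar> = 1}"
    unfolding assms(1) G by blast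
  then show ?thesis
    unfolding star_def facet_cone_def by simp
qed

text \<open>\<open>K\<close> is kept free because two choices are used: the hull of the other
  vectors, and the whole polytope, which gives the same volume for
  \<open>\<tau> \<ge> 1\<close>.\<close>

definition stretched_volume :: "(real^'k) set \<Rightarrow> real^'k \<Rightarrow> real \<Rightarrow> real" where
  "stretched_volume K v \<tau> = measure lebesgue (convex hull (insert (\<tau> *\<^sub>R v) (insert (- (\<tau> *\<^sub>R v)) K)))"

lemma stretched_volume_polar:
  fixes A :: "(real^'k) set"
  assumes "finite A" "bounded (polar A)"
  shows "stretched_volume (polar A) v \<tau>
       = measure lebesgue (polar A) + (\<Sum>a\<in>A. max 0 (\<bar>\<tau>\<bar> * \<bar>a \<bullet> v\<bar> - 1) * measure lebesgue (facet_cone (polar A) a))"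
  unfolding stretched_volume_def measure_convex_hull_insert_opposite_polar[OF assms] by (simp add: abs_mult)

text \<open>All \<open>\<bar>a \<bullet> v\<bar>\<close> are at most 1. For small
  \<open>t > 0\<close> only the facets with value 1 become visible, each adding \<open>t\<close>
  times its cone, and these cones make up the star.\<close>

lemma stretched_volume_star:
  fixes P :: "(real^'k) set"
  assumes P: "polytope P" "0 \<in> interior P" and v: "v \<in> P" "- v \<in> P"
  shows "\<forall>\<^sub>F t in at_right 0. stretched_volume P v (1 + t) = measure lebesgue P + t * measure lebesgue (star P v)"
proof -
  obtain A where A: "finite A" "P = polar A" "\<And>F. F facet_of P \<longleftrightarrow> (\<exists>a\<in>A. F = P \<inter> {x. a \<bullet> x = 1})"
    using polytope_eq_polar[OF P] by metis
  have bP: "bounded (polar A)" using P(1) A(2) polytope_imp_bounded by blast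
  let ?c = "\<lambda>a. measure lebesgue (facet_cone (polar A) a)"
  have le1: "\<bar>a \<bullet> v\<bar> \<le> 1" if "a \<in> A" for a
  proof -
    have "a \<bullet> v \<le> 1" "a \<bullet> (- v) \<le> 1" using v that unfolding A(2) polar_def by blast+
    then show ?thesis by (simp add: abs_le_iff)
  qed
  have star: "measure lebesgue (star P v) = (\<Sum>a\<in>{a \<in> A. \<bar>a \<bullet> v\<bar> = 1}. ?c a)"
    unfolding star_eq_UN_facet_cone[OF A(3) v] unfolding A(2)
    using A(1) bP by (intro measure_UN_facet_cone) auto
  have "\<forall>\<^sub>F t in at_right 0. \<forall>a\<in>A. \<bar>a \<bullet> v\<bar> < 1 \<longrightarrow> (1 + t) * \<bar>a \<bullet> v\<bar> < 1"
  proof (intro eventually_ball_finite[OF A(1)] ballI)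
    fix a assume "a \<in> A"
    show "\<forall>\<^sub>F t in at_right 0. \<bar>a \<bullet> v\<bar> < 1 \<longrightarrow> (1 + t) * \<bar>a \<bullet> v\<bar> < 1"
    proof (cases "\<bar>a \<bullet> v\<bar> < 1")
      case True
      have "((\<lambda>t. (1 + t) * \<bar>a \<bullet> v\<bar>) \<longlongrightarrow> (1 + 0) * \<bar>a \<bullet> v\<bar>) (at_right (0::real))"
        by (intro tendsto_intros)
      then have "\<forall>\<^sub>F t in at_right 0. (1 + t) * \<bar>a \<bullet> v\<bar> < 1"
        using True by (intro order_tendstoD(2)[where y = "(1 + 0) * \<bar>a \<bullet> v\<bar>"]) auto
      then show ?thesis by (rule eventually_mono) simp
    qed simp
  qed
  then show ?thesis
    using eventually_at_right_less[of 0]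
  proof eventually_elim
    case (elim t)
    have *: "max 0 (\<bar>1 + t\<bar> * \<bar>a \<bullet> v\<bar> - 1) = (if \<bar>a \<bullet> v\<bar> = 1 then t else 0)" if a: "a \<in> A" for a
    proof (cases "\<bar>a \<bullet> v\<bar> = 1")
      case False
      then have "\<bar>a \<bullet> v\<bar> < 1" using le1[OF a] by simp
      then show ?thesis using elim a False by (auto simp: max_def)
    qed (use elim in auto)
    have "stretched_volume P v (1 + t) = measure lebesgue P + (\<Sum>a\<in>A. (if \<bar>a \<bullet> v\<bar> = 1 then t else 0) * ?c a)"
      unfolding A(2) stretched_volume_polar[OF A(1) bP] by (simp add: * cong: sum.cong)
    also have "(\<Sum>a\<in>A. (if \<bar>a \<bullet> v\<bar> = 1 then t else 0) * ?c a) = (\<Sum>a\<in>{a \<in> A. \<bar>a \<bullet> v\<bar> = 1}. t * ?c a)"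
      using A(1) by (simp add: sum.inter_filter if_distrib[of "\<lambda>x. x * _"] cong: if_cong)
    also have "\<dots> = t * measure lebesgue (star P v)"
      by (simp add: star sum_distrib_left)
    finally show ?case .
  qed
qed

text \<open>Midpoint convexity at 1, inherited from the convex summands
  \<open>max 0 (\<bar>\<tau>\<bar> * \<bar>a \<bullet> v\<bar> - 1)\<close>.\<close>

lemma stretched_volume_convex:
  fixes K :: "(real^'k) set"
  assumes K: "polytope K" "0 \<in> interior K" and t: "0 < t" "t < 1"
  shows "2 * stretched_volume K v 1 \<le> stretched_volume K v (1 + t) + stretched_volume K v (1 - t)"
proof -
  obtain A where A: "finite A" "K = polar A"
    using polytope_eq_polar[OF K] by metis
  have bK: "bounded (polar A)" using K(1) A(2) polytope_imp_bounded by blast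
  let ?c = "\<lambda>a. measure lebesgue (facet_cone (polar A) a)"
  let ?m = "\<lambda>\<tau> a. max 0 (\<bar>\<tau>\<bar> * \<bar>a \<bullet> v\<bar> - 1)"
  define s where "s \<tau> = (\<Sum>a\<in>A. ?m \<tau> a * ?c a)" for \<tau>
  have sv: "stretched_volume K v \<tau> = measure lebesgue K + s \<tau>" for \<tau>
    unfolding A(2) stretched_volume_polar[OF A(1) bK] s_def ..
  have "(2 * ?m 1 a) * ?c a \<le> (?m (1 + t) a + ?m (1 - t) a) * ?c a" for a
    using t by (intro mult_right_mono) (auto simp: max_def algebra_simps)
  then have "(\<Sum>a\<in>A. (2 * ?m 1 a) * ?c a) \<le> (\<Sum>a\<in>A. (?m (1 + t) a + ?m (1 - t) a) * ?c a)"
    by (intro sum_mono)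
  then have "2 * s 1 \<le> s (1 + t) + s (1 - t)"
    by (simp only: s_def sum_distrib_left sum.distrib distrib_right mult.assoc)
  then show ?thesis by (simp add: sv)
qed

text \<open>The normal \<open>d\<close> of \<open>F\<close> has
  \<open>\<bar>d \<bullet> v\<bar> = 1\<close>. Its summand is 0 at \<open>1 - t\<close> and at 1
  but \<open>t * c\<close> at \<open>1 + t\<close>, where \<open>c > 0\<close> is the volume of the
  cone over \<open>F\<close>; the other summands are convex.\<close>

lemma stretched_volume_kink:
  fixes K :: "(real^'k) set"
  assumes K: "polytope K" "0 \<in> interior K" and F: "F facet_of K" "v \<in> affine hull F \<or> - v \<in> affine hull F"
  obtains c where "c > 0" "\<And>t. 0 < t \<Longrightarrow> t < 1 \<Longrightarrow>
    2 * stretched_volume K v 1 + t * c \<le> stretched_volume K v (1 + t) + stretched_volume K v (1 - t)"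
proof -
  obtain A where A: "finite A" "K = polar A" "\<And>F. F facet_of K \<longleftrightarrow> (\<exists>a\<in>A. F = K \<inter> {x. a \<bullet> x = 1})"
    using polytope_eq_polar[OF K] by metis
  have bK: "bounded (polar A)" using K(1) A(2) polytope_imp_bounded by blast
  obtain d where d: "d \<in> A" "F = K \<inter> {x. d \<bullet> x = 1}" using A(3) F(1) by blast
  have "affine hull F \<subseteq> {x. d \<bullet> x = 1}"
    using affine_hyperplane unfolding d(2) by (intro hull_minimal) auto
  then have dv: "\<bar>d \<bullet> v\<bar> = 1" using F(2) by auto
  let ?c = "\<lambda>a. measure lebesgue (facet_cone (polar A) a)"
  let ?m = "\<lambda>\<tau> a. max 0 (\<bar>\<tau>\<bar> * \<bar>a \<bullet> v\<bar> - 1)"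
  define s where "s \<tau> = (\<Sum>a\<in>A. ?m \<tau> a * ?c a)" for \<tau>
  have sv: "stretched_volume K v \<tau> = measure lebesgue K + s \<tau>" for \<tau>
    unfolding A(2) stretched_volume_polar[OF A(1) bK] s_def ..
  show thesis
  proof (rule that)
    have "affine hull K = UNIV" using K(2) by (intro affine_hull_nonempty_interior) auto
    then have "aff_dim K = DIM(real^'k)" using aff_dim_affine_hull[of K] by simp
    then show "0 < ?c d"
      using measure_facet_cone_pos[of K d] polytope_imp_compact[OF K(1)] F(1) d(2) A(2) by simp
    fix t :: real assume t: "0 < t" "t < 1"
    have "(2 * ?m 1 a + (if a = d then t else 0)) * ?c a \<le> (?m (1 + t) a + ?m (1 - t) a) * ?c a" for a
    proof (intro mult_right_mono)
      show "2 * ?m 1 a + (if a = d then t else 0) \<le> ?m (1 + t) a + ?m (1 - t) a"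
      proof (cases "a = d")
        case True
        then show ?thesis using dv t by simp
      qed (use t in \<open>auto simp: max_def algebra_simps\<close>)
    qed simp
    then have "(\<Sum>a\<in>A. (2 * ?m 1 a + (if a = d then t else 0)) * ?c a) \<le> (\<Sum>a\<in>A. (?m (1 + t) a + ?m (1 - t) a) * ?c a)"
      by (intro sum_mono)
    then have "2 * s 1 + (\<Sum>a\<in>A. (if a = d then t else 0) * ?c a) \<le> s (1 + t) + s (1 - t)"
      by (simp only: s_def sum_distrib_left sum.distrib distrib_right mult.assoc)
    moreover have "(\<Sum>a\<in>A. (if a = d then t else 0) * ?c a) = t * ?c d"
      using A(1) d(1) by (simp add: if_distrib[of "\<lambda>x. x * _"] sum.delta cong: if_cong)
    ultimately show "2 * stretched_volume K v 1 + t * ?c d \<le> stretched_volume K v (1 + t) + stretched_volume K v (1 - t)"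
      by (simp add: sv)
  qed
qed

text \<open>The rank-one map that fixes \<open>u \<bullet> x = 0\<close> pointwise and multiplies
  \<open>v\<close> by \<open>\<tau>\<close> has determinant \<open>\<tau>\<close>.\<close>

lemma stretched_volume_hyperplane:
  fixes K :: "(real^'k) set"
  assumes "compact K" "K \<subseteq> {x. u \<bullet> x = 0}" "u \<bullet> v \<noteq> 0"
  shows "stretched_volume K v \<tau> = \<bar>\<tau>\<bar> * stretched_volume K v 1"
proof -
  let ?a = "((\<tau> - 1) / (u \<bullet> v)) *\<^sub>R u"
  let ?f = "\<lambda>x. x + (?a \<bullet> x) *\<^sub>R v"
  have lf: "linear ?f" by (rule linear_rank_one)
  have av: "?a \<bullet> v = \<tau> - 1" using assms(3) by simp
  have "?f ` K = (\<lambda>x. x) ` K" by (intro image_cong refl) (use assms(2) in auto)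
  moreover have "?f v = \<tau> *\<^sub>R v" unfolding av by (simp add: scaleR_left_diff_distrib)
  moreover have "?f (- v) = - (\<tau> *\<^sub>R v)" unfolding inner_minus_right av by (simp add: scaleR_left_diff_distrib)
  ultimately have "?f ` (insert v (insert (- v) K)) = insert (\<tau> *\<^sub>R v) (insert (- (\<tau> *\<^sub>R v)) K)"
    by (simp only: image_insert image_ident)
  then have "convex hull (insert (\<tau> *\<^sub>R v) (insert (- (\<tau> *\<^sub>R v)) K)) = ?f ` (convex hull (insert v (insert (- v) K)))"
    by (simp only: convex_hull_linear_image[OF lf])
  then have "stretched_volume K v \<tau> = \<bar>1 + ?a \<bullet> v\<bar> * measure lebesgue (convex hull (insert v (insert (- v) K)))"
    unfolding stretched_volume_def using assms(1)
    by (simp only:) (intro measure_rank_one_image compact_convex_hull compact_insert)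
  then show ?thesis using assms(3) by (simp add: stretched_volume_def)
qed

subsection \<open>Stretching one vector of a frame\<close>

definition stretch :: "(real^'k)^'n \<Rightarrow> 'n \<Rightarrow> real \<Rightarrow> (real^'k)^'n" where
  "stretch S i \<tau> = (\<chi> j. if j = i then \<tau> *\<^sub>R S $ j else S $ j)"

lemma stretch_1 [simp]: "stretch S i 1 = S"
  by (simp add: stretch_def vec_eq_iff)

text \<open>The polarised Parseval identity. For the converse, a vector orthogonal to every
  \<open>S $ j\<close> is orthogonal to itself, which yields spanning.\<close>

lemma uframe_iff_inner:
  fixes S :: "(real^'k)^'n"
  shows "uframe S \<longleftrightarrow> (\<forall>x y. (\<Sum>j\<in>UNIV. (x \<bullet> S $ j) * (y \<bullet> S $ j)) = x \<bullet> y)"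
proof -
  have eq: "(\<Sum>j\<in>UNIV. outer (S $ j)) = mat 1 \<longleftrightarrow>
      (\<forall>a b. (\<Sum>j\<in>UNIV. S $ j $ a * S $ j $ b) = (if a = b then 1 else 0))"
    by (simp add: vec_eq_iff outer_def mat_def)
  show ?thesis
  proof
    assume "uframe S"
    then have o: "(\<Sum>j\<in>UNIV. S $ j $ a * S $ j $ b) = (if a = b then 1 else 0)" for a b
      using eq by (simp add: uframe_def)
    show "\<forall>x y. (\<Sum>j\<in>UNIV. (x \<bullet> S $ j) * (y \<bullet> S $ j)) = x \<bullet> y"
    proof (intro allI)
      fix x y :: "real^'k"
      have "(\<Sum>j\<in>UNIV. (x \<bullet> S $ j) * (y \<bullet> S $ j))
          = (\<Sum>j\<in>UNIV. \<Sum>a\<in>UNIV. \<Sum>b\<in>UNIV. x $ a * y $ b * (S $ j $ a * S $ j $ b))"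
        by (simp add: inner_vec_def sum_product mult_ac)
      also have "\<dots> = (\<Sum>a\<in>UNIV. \<Sum>j\<in>UNIV. \<Sum>b\<in>UNIV. x $ a * y $ b * (S $ j $ a * S $ j $ b))"
        by (rule sum.swap)
      also have "\<dots> = (\<Sum>a\<in>UNIV. \<Sum>b\<in>UNIV. \<Sum>j\<in>UNIV. x $ a * y $ b * (S $ j $ a * S $ j $ b))"
        by (intro sum.cong refl sum.swap)
      also have "\<dots> = (\<Sum>a\<in>UNIV. \<Sum>b\<in>UNIV. x $ a * y $ b * (if a = b then 1 else 0))"
        by (simp only: sum_distrib_left[symmetric] o)
      also have "\<dots> = x \<bullet> y" by (simp add: inner_vec_def if_distrib cong: if_cong)
      finally show "(\<Sum>j\<in>UNIV. (x \<bullet> S $ j) * (y \<bullet> S $ j)) = x \<bullet> y" .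
    qed
  next
    assume H: "\<forall>x y. (\<Sum>j\<in>UNIV. (x \<bullet> S $ j) * (y \<bullet> S $ j)) = x \<bullet> y"
    have "(\<Sum>j\<in>UNIV. S $ j $ a * S $ j $ b) = (if a = b then 1 else 0)" for a b
      using H[rule_format, of "axis a 1" "axis b 1"] by (auto simp: inner_axis' inner_axis_axis) (simp add: axis_def)
    moreover have "frame S"
      unfolding frame_def
    proof (rule ccontr)
      assume "span (range (\<lambda>i. S $ i)) \<noteq> UNIV"
      then obtain u where u: "u \<noteq> 0" "\<forall>x\<in>span (range (\<lambda>i. S $ i)). u \<bullet> x = 0"
        using span_not_UNIV_orthogonal by blast
      then have "u \<bullet> S $ j = 0" for j by (simp add: span_base)
      then have "(\<Sum>j\<in>UNIV. (u \<bullet> S $ j) * (u \<bullet> S $ j)) = 0" by simp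
      then have "u \<bullet> u = 0" unfolding H[rule_format] .
      with u show False by simp
    qed
    ultimately show "uframe S" by (simp add: uframe_def eq)
  qed
qed

lemma symhull_linear_image:
  assumes "linear f"
  shows "symhull (\<chi> j. f (S $ j)) = f ` symhull S"
proof -
  have "f ` ((\<lambda>i. S $ i) ` UNIV \<union> (\<lambda>i. - (S $ i)) ` UNIV)
      = (\<lambda>i. f (S $ i)) ` UNIV \<union> (\<lambda>i. - f (S $ i)) ` UNIV"
    by (simp add: image_Un image_image linear_neg[OF assms])
  then show ?thesis unfolding symhull_def convex_hull_linear_image[OF assms] by simp
qed

lemma polytope_symhull: "polytope (symhull S)"
  unfolding symhull_def by (rule polytope_convex_hull) simp

text \<open>Stretching perturbs the frame operator from the identity by a rank-one term.\<close>

lemma sum_inner_stretch: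
  fixes S :: "(real^'k)^'n"
  assumes "uframe S"
  shows "(\<Sum>j\<in>UNIV. (x \<bullet> stretch S i \<tau> $ j) * (y \<bullet> stretch S i \<tau> $ j))
       = x \<bullet> y + (\<tau>\<^sup>2 - 1) * (x \<bullet> S $ i) * (y \<bullet> S $ i)"
proof -
  have "(\<Sum>j\<in>UNIV. (x \<bullet> stretch S i \<tau> $ j) * (y \<bullet> stretch S i \<tau> $ j))
      = (\<Sum>j\<in>UNIV. (x \<bullet> S $ j) * (y \<bullet> S $ j) + (if j = i then (\<tau>\<^sup>2 - 1) * (x \<bullet> S $ j) * (y \<bullet> S $ j) else 0))"
    by (intro sum.cong refl) (simp add: stretch_def power2_eq_square algebra_simps)
  also have "\<dots> = x \<bullet> y + (\<tau>\<^sup>2 - 1) * (x \<bullet> S $ i) * (y \<bullet> S $ i)"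
    using assms by (simp add: sum.distrib uframe_iff_inner)
  finally show ?thesis .
qed

text \<open>If \<open>A\<close> is the frame operator of the stretched frame, then \<open>D = det A\<close>, and \<open>T\<close> is its image under
  \<open>A\<close> to the power \<open>-1/2\<close>, which is a rank-one perturbation of the identity.\<close>

lemma renormalised_stretch:
  fixes S :: "(real^'k)^'n" and i :: 'n and \<tau> :: real
  defines "q \<equiv> S $ i \<bullet> S $ i"
  defines "D \<equiv> 1 + (\<tau>\<^sup>2 - 1) * q"
  defines "\<beta> \<equiv> (1 / sqrt D - 1) / q"
  defines "T \<equiv> (\<chi> j. stretch S i \<tau> $ j + ((\<beta> *\<^sub>R S $ i) \<bullet> stretch S i \<tau> $ j) *\<^sub>R S $ i)"
  assumes S: "uframe S" "S $ i \<noteq> 0" and D: "D > 0"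
  shows "uframe T" "vol_fun (stretch S i \<tau>) = sqrt D * vol_fun T"
proof -
  let ?v = "S $ i"
  define B where "B x = x + ((\<beta> *\<^sub>R ?v) \<bullet> x) *\<^sub>R ?v" for x
  have q: "q > 0" using S(2) by (simp add: q_def)
  \<comment> \<open>The frame operator multiplies \<open>?v\<close> by \<open>D\<close> and fixes
    its orthogonal complement. The value of \<open>\<beta>\<close> makes \<open>B\<close> do the
    same with factor \<open>g\<close>.\<close>
  define g where "g = 1 / sqrt D"
  have g: "g\<^sup>2 * D = 1" "1 + \<beta> * q = g" "g > 0"
    using D q by (simp_all add: g_def \<beta>_def power_divide)
  have T: "T $ j = B (stretch S i \<tau> $ j)" for j by (simp add: T_def B_def)
  have sym: "x \<bullet> B y = B x \<bullet> y" for x y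
    by (simp add: B_def inner_add_right inner_add_left inner_commute)
  have Bv: "B x \<bullet> ?v = g * (x \<bullet> ?v)" for x
    by (simp add: B_def inner_add_left inner_commute q_def[symmetric] g(2)[symmetric] algebra_simps)
  have BB: "B x \<bullet> B y = x \<bullet> y + (2 * \<beta> + \<beta>\<^sup>2 * q) * (x \<bullet> ?v) * (y \<bullet> ?v)" for x y
    by (simp add: B_def inner_add_left inner_add_right inner_commute q_def[symmetric] power2_eq_square algebra_simps)
  \<comment> \<open>The coefficient of the rank-one term in the frame operator of \<open>T\<close>.
    Multiplied by \<open>q > 0\<close> it becomes \<open>g\<^sup>2 * D - 1\<close>.\<close>
  have z: "2 * \<beta> + \<beta>\<^sup>2 * q + (\<tau>\<^sup>2 - 1) * g\<^sup>2 = 0"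
  proof -
    have "q * (2 * \<beta> + \<beta>\<^sup>2 * q + (\<tau>\<^sup>2 - 1) * g\<^sup>2) = (1 + \<beta> * q)\<^sup>2 - 1 + (D - 1) * g\<^sup>2"
      by (simp add: D_def power2_eq_square algebra_simps)
    also have "\<dots> = 0" using g(1) by (simp add: g(2) algebra_simps)
    finally show ?thesis using q by simp
  qed
  show "uframe T"
    unfolding uframe_iff_inner
  proof (intro allI)
    fix x y
    have "(\<Sum>j\<in>UNIV. (x \<bullet> T $ j) * (y \<bullet> T $ j)) = B x \<bullet> B y + (\<tau>\<^sup>2 - 1) * (B x \<bullet> ?v) * (B y \<bullet> ?v)"
      using sum_inner_stretch[OF S(1), of "B x" i \<tau> "B y"] by (simp only: T sym)
    also have "\<dots> = x \<bullet> y + (2 * \<beta> + \<beta>\<^sup>2 * q + (\<tau>\<^sup>2 - 1) * g\<^sup>2) * (x \<bullet> ?v) * (y \<bullet> ?v)"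
      unfolding BB Bv by (simp add: power2_eq_square algebra_simps)
    finally show "(\<Sum>j\<in>UNIV. (x \<bullet> T $ j) * (y \<bullet> T $ j)) = x \<bullet> y" by (simp add: z)
  qed
  have "symhull T = (\<lambda>x. x + ((\<beta> *\<^sub>R ?v) \<bullet> x) *\<^sub>R ?v) ` symhull (stretch S i \<tau>)"
    unfolding T_def by (rule symhull_linear_image) (rule linear_rank_one)
  moreover have "measure lebesgue ((\<lambda>x. x + ((\<beta> *\<^sub>R ?v) \<bullet> x) *\<^sub>R ?v) ` symhull (stretch S i \<tau>))
      = \<bar>1 + (\<beta> *\<^sub>R ?v) \<bullet> ?v\<bar> * vol_fun (stretch S i \<tau>)"
    unfolding vol_fun_def by (rule measure_rank_one_image[OF polytope_imp_compact[OF polytope_symhull]])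
  ultimately have "vol_fun T = \<bar>1 + (\<beta> *\<^sub>R ?v) \<bullet> ?v\<bar> * vol_fun (stretch S i \<tau>)"
    by (simp only: vol_fun_def)
  also have "1 + (\<beta> *\<^sub>R ?v) \<bullet> ?v = g" by (simp add: q_def[symmetric] g(2))
  finally show "vol_fun (stretch S i \<tau>) = sqrt D * vol_fun T"
    using D by (simp add: g_def)
qed

text \<open>The square root lies below its tangent at 1; this makes the volume bound polynomial in
  \<open>\<tau>\<close>.\<close>

lemma sqrt_one_plus_le:
  assumes "0 \<le> 1 + (y::real)"
  shows "sqrt (1 + y) \<le> 1 + y / 2"
proof (rule real_le_lsqrt)
  show "0 \<le> 1 + y / 2" using assms by simp
  show "1 + y \<le> (1 + y / 2)\<^sup>2" by (simp add: power2_eq_square algebra_simps)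
qed

text \<open>The renormalised frames \<open>T \<tau>\<close> tend to \<open>S\<close> as
  \<open>\<tau>\<close> tends to 1, so near 1 they compete with \<open>S\<close> in the local
  maximum.\<close>

lemma local_max_stretch_bound:
  fixes S :: "(real^'k)^'n"
  assumes S: "uframe S" "S $ i \<noteq> 0"
    and max: "e > 0" "\<forall>S'\<in>Omega. dist S' S < e \<longrightarrow> vol_fun S' \<le> vol_fun S"
  shows "\<forall>\<^sub>F \<tau> in nhds 1. vol_fun (stretch S i \<tau>) \<le> (1 + (\<tau>\<^sup>2 - 1) * (S $ i \<bullet> S $ i) / 2) * vol_fun S"
proof -
  define q where "q = S $ i \<bullet> S $ i"
  define D where "D \<tau> = 1 + (\<tau>\<^sup>2 - 1) * q" for \<tau>
  define \<beta> where "\<beta> \<tau> = (1 / sqrt (D \<tau>) - 1) / q" for \<tau>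
  define T where "T \<tau> = (\<chi> j. stretch S i \<tau> $ j + ((\<beta> \<tau> *\<^sub>R S $ i) \<bullet> stretch S i \<tau> $ j) *\<^sub>R S $ i)" for \<tau>
  have id: "((\<lambda>\<tau>::real. \<tau>) \<longlongrightarrow> 1) (nhds 1)" by (rule filterlim_ident)
  have D1: "(D \<longlongrightarrow> 1 + (1\<^sup>2 - 1) * q) (nhds 1)"
    unfolding D_def by (intro tendsto_intros id)
  then have D1: "(D \<longlongrightarrow> 1) (nhds 1)" by simp
  have "(\<beta> \<longlongrightarrow> (1 / sqrt 1 - 1) / q) (nhds 1)"
    unfolding \<beta>_def using S(2) by (intro tendsto_intros D1) (auto simp: q_def)
  then have b0: "(\<beta> \<longlongrightarrow> 0) (nhds 1)" by simp
  have st: "((\<lambda>\<tau>. stretch S i \<tau> $ j) \<longlongrightarrow> S $ j) (nhds 1)" for j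
  proof (cases "j = i")
    case True
    have "((\<lambda>\<tau>. \<tau> *\<^sub>R S $ j) \<longlongrightarrow> 1 *\<^sub>R S $ j) (nhds 1)" by (intro tendsto_intros id)
    then show ?thesis using True by (simp add: stretch_def)
  qed (simp add: stretch_def)
  have "((\<lambda>\<tau>. T \<tau>) \<longlongrightarrow> S) (nhds 1)"
  proof (rule vec_tendstoI)
    fix j
    have "((\<lambda>\<tau>. stretch S i \<tau> $ j + ((\<beta> \<tau> *\<^sub>R S $ i) \<bullet> stretch S i \<tau> $ j) *\<^sub>R S $ i)
        \<longlongrightarrow> S $ j + ((0 *\<^sub>R S $ i) \<bullet> S $ j) *\<^sub>R S $ i) (nhds 1)"
      by (intro tendsto_intros b0 st)
    then show "((\<lambda>\<tau>. T \<tau> $ j) \<longlongrightarrow> S $ j) (nhds 1)" by (simp add: T_def)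
  qed
  then have "\<forall>\<^sub>F \<tau> in nhds 1. dist (T \<tau>) S < e" using max(1) by (rule tendstoD)
  moreover have "\<forall>\<^sub>F \<tau> in nhds 1. D \<tau> > 0" using D1 by (rule order_tendstoD) simp
  ultimately show ?thesis
  proof eventually_elim
    case (elim \<tau>)
    note D = elim(2)[unfolded D_def q_def]
    note ren = renormalised_stretch[OF S D, folded q_def, folded D_def, folded \<beta>_def, folded T_def]
    have "vol_fun (T \<tau>) \<le> vol_fun S" using max(2) elim(1) ren(1) by (auto simp: Omega_def)
    then have "vol_fun (stretch S i \<tau>) \<le> sqrt (D \<tau>) * vol_fun S"
      unfolding ren(2) using elim(2) by (intro mult_left_mono) auto
    also have "\<dots> \<le> (1 + (\<tau>\<^sup>2 - 1) * q / 2) * vol_fun S"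
      using sqrt_one_plus_le[of "(\<tau>\<^sup>2 - 1) * q"] elim(2)
      by (intro mult_right_mono) (auto simp: D_def vol_fun_def)
    finally show ?case by (simp add: q_def)
  qed
qed

section \<open>Symmetric hulls, with all vectors or with one left out\<close>

definition signed_vectors :: "(real^'k)^'n \<Rightarrow> 'n set \<Rightarrow> (real^'k) set" where
  "signed_vectors S J = (\<lambda>j. S $ j) ` J \<union> (\<lambda>j. - (S $ j)) ` J"

lemma finite_signed_vectors [simp]: "finite (signed_vectors S J)"
  for S :: "(real^'k)^'n"
  by (simp add: signed_vectors_def)

lemma uminus_signed_vectors: "x \<in> signed_vectors S J \<Longrightarrow> - x \<in> signed_vectors S J"
  by (auto simp: signed_vectors_def)

lemma symhull_eq: "symhull S = convex hull (signed_vectors S UNIV)"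
  by (simp add: symhull_def signed_vectors_def)

lemma uminus_convex_hull:
  fixes T :: "'a::euclidean_space set"
  assumes "\<And>x. x \<in> T \<Longrightarrow> - x \<in> T"
  shows "uminus ` (convex hull T) = convex hull T"
proof -
  have "uminus ` T = T" using assms by (auto simp: image_iff) (metis minus_minus)
  then show ?thesis using convex_hull_linear_image[OF linear_uminus, of T] by simp
qed

text \<open>A full-dimensional convex set has an interior point \<open>y\<close>; by symmetry
  \<open>- y\<close> is interior too, and 0 is their midpoint.\<close>

lemma zero_in_interior_convex_hull:
  fixes T :: "'a::euclidean_space set"
  assumes sym: "\<And>x. x \<in> T \<Longrightarrow> - x \<in> T" and span: "span T = UNIV" and ne: "T \<noteq> {}"
  shows "0 \<in> interior (convex hull T)"
proof -
  let ?C = "convex hull T"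
  have mid: "0 \<in> X" if "convex X" "x \<in> X" "- x \<in> X" for X and x :: 'a
    using convexD[OF that, of "1/2" "1/2"] by simp
  obtain x where "x \<in> T" using ne by blast
  then have 0: "0 \<in> ?C" using sym by (intro mid[of _ x]) (auto intro: hull_inc)
  have "affine hull ?C = span ?C"
    using hull_inc[OF 0, of affine] by (rule affine_hull_span_0)
  also have "\<dots> = UNIV" using span span_mono[OF hull_subset[of T convex]] by auto
  finally have "aff_dim ?C = DIM('a)" using aff_dim_affine_hull[of ?C] by simp
  then have "interior ?C \<noteq> {}"
    using 0 by (auto simp: interior_rel_interior_gen rel_interior_eq_empty)
  then obtain y where y: "y \<in> interior ?C" by blast
  have "interior ?C = uminus ` interior ?C"
    using interior_negations[of ?C] uminus_convex_hull[OF sym] by simp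
  then have "- y \<in> interior ?C" using y by blast
  with y show ?thesis by (intro mid[of _ y]) auto
qed

lemma span_signed_vectors: "span (signed_vectors S J) = span ((\<lambda>j. S $ j) ` J)"
proof
  have "x \<in> span ((\<lambda>j. S $ j) ` J)" if x: "x \<in> signed_vectors S J" for x
  proof -
    obtain j where "j \<in> J" "x = S $ j \<or> x = - (S $ j)" using x by (auto simp: signed_vectors_def)
    moreover from this have "S $ j \<in> span ((\<lambda>j. S $ j) ` J)" by (intro span_base) simp
    ultimately show ?thesis using span_neg by metis
  qed
  then show "span (signed_vectors S J) \<subseteq> span ((\<lambda>j. S $ j) ` J)"
    by (intro span_minimal) auto
  show "span ((\<lambda>j. S $ j) ` J) \<subseteq> span (signed_vectors S J)"
    by (rule span_mono) (simp add: signed_vectors_def)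
qed

lemma frame_interior:
  fixes S :: "(real^'k)^'n"
  assumes "frame S"
  shows "0 \<in> interior (symhull S)"
  unfolding symhull_eq using assms
  by (intro zero_in_interior_convex_hull uminus_signed_vectors)
    (auto simp: span_signed_vectors frame_def, auto simp: signed_vectors_def)

lemma frame_vol_fun_pos:
  fixes S :: "(real^'k)^'n"
  assumes "frame S"
  shows "vol_fun S > 0"
  unfolding vol_fun_def
proof (rule measure_pos_aff_dim_full)
  show "convex (symhull S)" by (simp add: symhull_def)
  show "symhull S \<in> lmeasurable"
    by (intro lmeasurable_compact polytope_imp_compact polytope_symhull)
  have "affine hull (symhull S) = UNIV"
    using frame_interior[OF assms] by (intro affine_hull_nonempty_interior) auto
  then show "aff_dim (symhull S) = DIM(real^'k)" using aff_dim_affine_hull[of "symhull S"] by simp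
qed

lemma hull_insert_insert:
  "P hull (insert a (insert b (P hull T))) = P hull (insert a (insert b T))"
proof -
  have "P hull (insert a (insert b (P hull T))) = P hull (insert a (P hull (insert b (P hull T))))"
    by (rule hull_insert)
  also have "P hull (insert b (P hull T)) = P hull (insert b T)" by (rule hull_insert[symmetric])
  also have "P hull (insert a (P hull (insert b T))) = P hull (insert a (insert b T))"
    by (rule hull_insert[symmetric])
  finally show ?thesis .
qed

lemma symhull_stretch:
  "symhull (stretch S i \<tau>) = convex hull (insert (\<tau> *\<^sub>R S $ i) (insert (- (\<tau> *\<^sub>R S $ i)) (convex hull (signed_vectors S (- {i})))))"
proof -
  have "signed_vectors (stretch S i \<tau>) UNIV
      = insert (\<tau> *\<^sub>R S $ i) (insert (- (\<tau> *\<^sub>R S $ i)) (signed_vectors S (- {i})))"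
    by (auto simp: signed_vectors_def stretch_def)
  then show ?thesis by (simp only: symhull_eq hull_insert_insert)
qed

lemma vol_fun_stretch:
  "vol_fun (stretch S i \<tau>) = stretched_volume (convex hull (signed_vectors S (- {i}))) (S $ i) \<tau>"
  by (simp add: vol_fun_def symhull_stretch stretched_volume_def)

text \<open>The segment between the stretched points contains \<open>S $ i\<close> and
  \<open>- (S $ i)\<close>, so adjoining these to the other vectors does not enlarge the
  hull.\<close>

lemma vol_fun_stretch_symhull:
  fixes S :: "(real^'k)^'n"
  assumes "t \<ge> 0"
  shows "vol_fun (stretch S i (1 + t)) = stretched_volume (symhull S) (S $ i) (1 + t)"
proof -
  let ?w = "(1 + t) *\<^sub>R S $ i" and ?T = "signed_vectors S (- {i})"
  have sub: "S $ i \<in> convex hull {?w, - ?w}" "- (S $ i) \<in> convex hull {?w, - ?w}"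
  proof -
    \<comment> \<open>The solution of \<open>(1 - 2 * s) * (1 + t) = 1\<close>: with weight
      \<open>s\<close> on the opposite end the combination is \<open>S $ i\<close>.\<close>
    define s where "s = t / (2 * (1 + t))"
    have s: "0 \<le> s" "s \<le> 1" "(1 - 2 * s) * (1 + t) = 1" using assms by (auto simp: s_def field_simps)
    have "(1 - s) *\<^sub>R ?w + s *\<^sub>R (- ?w) = ((1 - 2 * s) * (1 + t)) *\<^sub>R S $ i"
      "s *\<^sub>R ?w + (1 - s) *\<^sub>R (- ?w) = - (((1 - 2 * s) * (1 + t)) *\<^sub>R S $ i)"
      by (simp_all add: vec_eq_iff algebra_simps)
    then have "(1 - s) *\<^sub>R ?w + s *\<^sub>R (- ?w) = S $ i" "s *\<^sub>R ?w + (1 - s) *\<^sub>R (- ?w) = - (S $ i)"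
      by (simp_all add: s(3))
    moreover have "?w \<in> convex hull {?w, - ?w}" "- ?w \<in> convex hull {?w, - ?w}" by (auto intro: hull_inc)
    ultimately show "S $ i \<in> convex hull {?w, - ?w}" "- (S $ i) \<in> convex hull {?w, - ?w}"
      using s(1,2) convexD[OF convex_convex_hull, of ?w "{?w, - ?w}" "- ?w"] by (metis diff_add_cancel diff_ge_0_iff_ge add.commute)+
  qed
  have le: "convex hull {?w, - ?w} \<subseteq> convex hull (insert ?w (insert (- ?w) ?T))"
    by (rule hull_mono) auto
  have eq: "convex hull (insert ?w (insert (- ?w) ?T)) = convex hull (insert ?w (insert (- ?w) (symhull S)))"
  proof
    have T: "?T \<subseteq> symhull S"
      unfolding symhull_eq by (rule subset_trans[OF _ hull_subset]) (auto simp: signed_vectors_def)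
    then show "convex hull (insert ?w (insert (- ?w) ?T)) \<subseteq> convex hull (insert ?w (insert (- ?w) (symhull S)))"
      by (intro hull_mono) auto
    have "signed_vectors S UNIV \<subseteq> convex hull (insert ?w (insert (- ?w) ?T))"
    proof
      fix x assume "x \<in> signed_vectors S UNIV"
      then have "x = S $ i \<or> x = - (S $ i) \<or> x \<in> ?T" by (auto simp: signed_vectors_def)
      then show "x \<in> convex hull (insert ?w (insert (- ?w) ?T))"
        using sub le by (auto intro: hull_inc)
    qed
    then have "symhull S \<subseteq> convex hull (insert ?w (insert (- ?w) ?T))"
      unfolding symhull_eq by (rule hull_minimal) simp
    then show "convex hull (insert ?w (insert (- ?w) (symhull S))) \<subseteq> convex hull (insert ?w (insert (- ?w) ?T))"
      by (intro hull_minimal) (auto intro: hull_inc)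
  qed
  have "symhull (stretch S i (1 + t)) = convex hull (insert ?w (insert (- ?w) ?T))"
    by (simp only: symhull_stretch hull_insert_insert)
  then show ?thesis unfolding vol_fun_def stretched_volume_def by (simp only: eq)
qed

text \<open>Either the other vectors span the space and their hull has 0 in its interior, or they
  lie in a hyperplane missing \<open>S $ i\<close> and the volume is linear in the factor.\<close>

lemma vol_fun_stretch_convex:
  fixes S :: "(real^'k)^'n"
  assumes "frame S" "0 < t" "t < 1"
  shows "2 * vol_fun S \<le> vol_fun (stretch S i (1 + t)) + vol_fun (stretch S i (1 - t))"
proof -
  let ?T = "signed_vectors S (- {i})"
  have "2 * stretched_volume (convex hull ?T) (S $ i) 1
      \<le> stretched_volume (convex hull ?T) (S $ i) (1 + t) + stretched_volume (convex hull ?T) (S $ i) (1 - t)"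
  proof (cases "span ?T = UNIV \<and> ?T \<noteq> {}")
    case True
    then show ?thesis
      using assms by (intro stretched_volume_convex polytope_convex_hull zero_in_interior_convex_hull uminus_signed_vectors) auto
  next
    case False
    \<comment> \<open>An empty \<open>?T\<close> belongs to this case: its span is
      \<open>{0}\<close>, and the space is nonzero.\<close>
    have "span ?T \<noteq> UNIV"
    proof
      assume sp: "span ?T = UNIV"
      then have "span {} = (UNIV :: (real^'k) set)" using False by auto
      moreover have "(axis undefined 1 :: real^'k) \<noteq> 0" by (simp add: axis_eq_0_iff)
      ultimately show False by (metis UNIV_I singletonD span_empty)
    qed
    then obtain u where u: "u \<noteq> 0" "\<And>x. x \<in> span ?T \<Longrightarrow> u \<bullet> x = 0"
      using span_not_UNIV_orthogonal[of ?T] by auto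
    have "u \<bullet> S $ i \<noteq> 0"
    proof
      assume "u \<bullet> S $ i = 0"
      moreover have "u \<bullet> S $ j = 0" if "j \<noteq> i" for j
        using that by (intro u(2) span_base) (auto simp: signed_vectors_def)
      ultimately have "u \<bullet> S $ j = 0" for j by (cases "j = i") auto
      then have "range (\<lambda>j. S $ j) \<subseteq> {x. u \<bullet> x = 0}" by auto
      then have "span (range (\<lambda>j. S $ j)) \<subseteq> {x. u \<bullet> x = 0}"
        by (rule span_minimal) (rule subspace_hyperplane)
      moreover have "u \<in> span (range (\<lambda>j. S $ j))" using assms(1) by (simp add: frame_def)
      ultimately have "u \<bullet> u = 0" by blast
      with u(1) show False by simp
    qed
    moreover have "convex hull ?T \<subseteq> {x. u \<bullet> x = 0}"
      using u(2) by (intro hull_minimal convex_hyperplane) (auto intro: span_base)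
    ultimately have "stretched_volume (convex hull ?T) (S $ i) \<tau> = \<bar>\<tau>\<bar> * stretched_volume (convex hull ?T) (S $ i) 1" for \<tau>
      by (intro stretched_volume_hyperplane compact_convex_hull finite_imp_compact finite_signed_vectors)
    from this[of "1 + t"] this[of "1 - t"] show ?thesis
      using assms by (simp add: algebra_simps)
  qed
  then show ?thesis by (simp flip: vol_fun_stretch)
qed

lemma star_uminus: "star P (- v) = star P v"
  unfolding star_def by (metis minus_minus)

subsection \<open>Local maxima\<close>

lemma eventually_at_right_unit: "\<forall>\<^sub>F t::real in at_right 0. 0 < t \<and> t < 1"
  unfolding eventually_at_right_field by (rule exI[of _ 1]) auto

text \<open>Substitution of \<open>1 + t\<close> and \<open>1 - t\<close> for \<open>\<tau>\<close>.
  Both bounds are put on the same one-sided filter so that they can be added.\<close>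

lemma eventually_stretch_bounds:
  assumes ev: "\<forall>\<^sub>F \<tau> in nhds 1. f \<tau> \<le> (1 + (\<tau>\<^sup>2 - 1) * q / 2) * (V::real)"
  shows "\<forall>\<^sub>F t in at_right 0. f (1 + t) \<le> V + V * q * (t + t\<^sup>2 / 2)"
    and "\<forall>\<^sub>F t in at_right 0. f (1 - t) \<le> V + V * q * (- t + t\<^sup>2 / 2)"
proof -
  have "((\<lambda>t::real. 1 + t) \<longlongrightarrow> 1 + 0) (at_right 0)" "((\<lambda>t::real. 1 - t) \<longlongrightarrow> 1 - 0) (at_right 0)"
    by (intro tendsto_intros)+
  then have lim: "filterlim (\<lambda>t::real. 1 + t) (nhds 1) (at_right 0)" "filterlim (\<lambda>t::real. 1 - t) (nhds 1) (at_right 0)"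
    by simp_all
  show "\<forall>\<^sub>F t in at_right 0. f (1 + t) \<le> V + V * q * (t + t\<^sup>2 / 2)"
    using eventually_compose_filterlim[OF ev lim(1)] by eventually_elim (simp add: power2_eq_square field_simps)
  show "\<forall>\<^sub>F t in at_right 0. f (1 - t) \<le> V + V * q * (- t + t\<^sup>2 / 2)"
    using eventually_compose_filterlim[OF ev lim(2)] by eventually_elim (simp add: power2_eq_square field_simps)
qed

text \<open>For small \<open>t > 0\<close> the volume grows by exactly \<open>t * ?N\<close>. The
  bound at \<open>1 + t\<close> gives \<open>?N \<le> ?V * ?q\<close> in the limit; the bound at
  \<open>1 - t\<close> with convexity gives the reverse.\<close>

lemma local_max_norm:
  fixes S :: "(real^'k)^'n"
  assumes S: "uframe S" "S $ i \<noteq> 0"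
    and max: "e > 0" "\<forall>S'\<in>Omega. dist S' S < e \<longrightarrow> vol_fun S' \<le> vol_fun S"
  shows "measure lebesgue (star (symhull S) (S $ i)) = vol_fun S * (norm (S $ i))\<^sup>2"
proof -
  let ?V = "vol_fun S" and ?N = "measure lebesgue (star (symhull S) (S $ i))" and ?q = "(norm (S $ i))\<^sup>2"
  let ?f = "\<lambda>\<tau>. vol_fun (stretch S i \<tau>)"
  have frame: "frame S" using S(1) by (simp add: uframe_def)
  have "\<forall>\<^sub>F \<tau> in nhds 1. ?f \<tau> \<le> (1 + (\<tau>\<^sup>2 - 1) * ?q / 2) * ?V"
    using local_max_stretch_bound[OF S max] by (simp add: power2_norm_eq_inner)
  note bounds = eventually_stretch_bounds[OF this]
  have mem: "S $ i \<in> symhull S" "- (S $ i) \<in> symhull S"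
    unfolding symhull_eq by (auto intro!: hull_inc simp: signed_vectors_def)
  have pos: "\<forall>\<^sub>F t::real in at_right 0. 0 < t \<and> t < 1"
    by (rule eventually_at_right_unit)
  have grow: "\<forall>\<^sub>F t in at_right 0. ?f (1 + t) = ?V + t * ?N"
    using stretched_volume_star[OF polytope_symhull frame_interior[OF frame] mem, folded vol_fun_def] pos
    by eventually_elim (simp add: vol_fun_stretch_symhull)
  have upper: "\<forall>\<^sub>F t in at_right 0. ?N \<le> ?V * ?q * (1 + t / 2)"
    using bounds(1) grow pos
  proof eventually_elim
    case (elim t)
    then have "t * ?N \<le> t * (?V * ?q * (1 + t / 2))" by (simp add: power2_eq_square algebra_simps)
    then show ?case using elim by (simp only: mult_le_cancel_left_pos)
  qed
  have lower: "\<forall>\<^sub>F t in at_right 0. ?N \<ge> ?V * ?q * (1 - t / 2)"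
    using bounds(2) grow pos
  proof eventually_elim
    case (elim t)
    have "2 * ?V \<le> ?f (1 + t) + ?f (1 - t)" using elim by (intro vol_fun_stretch_convex[OF frame]) auto
    then have "t * (?V * ?q * (1 - t / 2)) \<le> t * ?N" using elim by (simp add: power2_eq_square algebra_simps)
    then show ?case using elim by (simp only: mult_le_cancel_left_pos)
  qed
  have "((\<lambda>t. ?V * ?q * (1 + t / 2)) \<longlongrightarrow> ?V * ?q * (1 + 0 / 2)) (at_right 0)"
    by (intro tendsto_intros) simp
  then have "?N \<le> ?V * ?q * (1 + 0 / 2)" using upper by (rule tendsto_lowerbound) simp
  moreover have "((\<lambda>t. ?V * ?q * (1 - t / 2)) \<longlongrightarrow> ?V * ?q * (1 - 0 / 2)) (at_right 0)"
    by (intro tendsto_intros) simp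
  then have "?N \<ge> ?V * ?q * (1 - 0 / 2)" using lower by (rule tendsto_upperbound) simp
  ultimately show ?thesis by simp
qed

text \<open>Adding the bounds at \<open>1 + t\<close> and \<open>1 - t\<close> cancels the linear
  terms and leaves an excess of order \<open>t\<^sup>2\<close> over \<open>2 * ?V\<close>, whereas a
  kink forces an excess of at least \<open>t * c\<close>.\<close>

lemma local_max_no_kink:
  fixes S :: "(real^'k)^'n"
  assumes S: "uframe S" "S $ i \<noteq> 0"
    and max: "e > 0" "\<forall>S'\<in>Omega. dist S' S < e \<longrightarrow> vol_fun S' \<le> vol_fun S"
    and F: "0 \<in> interior (convex hull (signed_vectors S (- {i})))" "F facet_of convex hull (signed_vectors S (- {i}))"
  shows "S $ i \<notin> affine hull F" "- (S $ i) \<notin> affine hull F"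
proof -
  have False if v: "S $ i \<in> affine hull F \<or> - (S $ i) \<in> affine hull F"
  proof -
    let ?f = "\<lambda>\<tau>. vol_fun (stretch S i \<tau>)" and ?V = "vol_fun S" and ?q = "(norm (S $ i))\<^sup>2"
    have K: "polytope (convex hull (signed_vectors S (- {i})))" by (simp add: polytope_convex_hull)
    obtain c where c: "c > 0" "\<And>t. 0 < t \<Longrightarrow> t < 1 \<Longrightarrow> 2 * ?f 1 + t * c \<le> ?f (1 + t) + ?f (1 - t)"
      using stretched_volume_kink[OF K F v, folded vol_fun_stretch] by blast
    have "\<forall>\<^sub>F \<tau> in nhds 1. ?f \<tau> \<le> (1 + (\<tau>\<^sup>2 - 1) * ?q / 2) * ?V"
      using local_max_stretch_bound[OF S max] by (simp add: power2_norm_eq_inner)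
    note bounds = eventually_stretch_bounds[OF this]
    have pos: "\<forall>\<^sub>F t::real in at_right 0. 0 < t \<and> t < 1"
      by (rule eventually_at_right_unit)
    have le: "\<forall>\<^sub>F t in at_right 0. c \<le> ?V * ?q * t"
      using bounds pos
    proof eventually_elim
      case (elim t)
      have "2 * ?V + t * c \<le> ?f (1 + t) + ?f (1 - t)" using elim c(2)[of t] by simp
      with elim have "t * c \<le> ?V * ?q * (t + t\<^sup>2 / 2) + ?V * ?q * (- t + t\<^sup>2 / 2)" by linarith
      also have "\<dots> = t * (?V * ?q * t)" by (simp add: power2_eq_square algebra_simps)
      finally have "t * c \<le> t * (?V * ?q * t)" .
      then show ?case using elim by (simp only: mult_le_cancel_left_pos)
    qed
    have "((\<lambda>t. ?V * ?q * t) \<longlongrightarrow> ?V * ?q * 0) (at_right 0)" by (intro tendsto_intros)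
    then have "c \<le> ?V * ?q * 0" using le by (rule tendsto_lowerbound) simp
    with c(1) show False by simp
  qed
  then show "S $ i \<notin> affine hull F" "- (S $ i) \<notin> affine hull F" by blast+
qed

lemma facet_simplex:
  fixes S :: "(real^'k)^'n"
  assumes S: "uframe S"
    and max: "e > 0" "\<forall>S'\<in>Omega. dist S' S < e \<longrightarrow> vol_fun S' \<le> vol_fun S"
    and F: "F facet_of symhull S"
  shows "\<exists>m. m simplex F"
proof -
  let ?P = "symhull S"
  have frame: "frame S" using S by (simp add: uframe_def)
  obtain A where A: "?P = polar A" "\<And>F. F facet_of ?P \<longleftrightarrow> (\<exists>a\<in>A. F = ?P \<inter> {x. a \<bullet> x = 1})"
    using polytope_eq_polar[OF polytope_symhull frame_interior[OF frame]] by metis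
  obtain a where a: "a \<in> A" "F = ?P \<inter> {x. a \<bullet> x = 1}" using A(2) F by blast
  have aP: "a \<bullet> x \<le> 1" if "x \<in> ?P" for x using that a(1) unfolding A(1) by (simp add: polar_def)
  obtain W where W: "W \<subseteq> signed_vectors S UNIV" "F = convex hull W"
    using F face_of_convex_hull_subset[of "signed_vectors S UNIV" F] unfolding symhull_eq facet_of_def
    by (metis finite_signed_vectors finite_imp_compact)
  have aW: "a \<bullet> x = 1" if "x \<in> W" for x
    using that hull_inc[of x W convex] W(2) a(2) by blast
  have "\<not> affine_dependent W"
  proof
    assume "affine_dependent W"
    then obtain w where w: "w \<in> W" "w \<in> affine hull (W - {w})" by (auto simp: affine_dependent_def)
    obtain i where i: "w = S $ i \<or> w = - (S $ i)" using w(1) W(1) by (auto simp: signed_vectors_def)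
    let ?T = "signed_vectors S (- {i})" and ?W = "W - {w}"
    let ?F = "convex hull ?T \<inter> {x. a \<bullet> x = 1}"
    have WT: "?W \<subseteq> ?T"
    proof
      fix x assume x: "x \<in> ?W"
      then obtain j where j: "x = S $ j \<or> x = - (S $ j)" using W(1) by (auto simp: signed_vectors_def)
      \<comment> \<open>Both lie in \<open>a \<bullet> x = 1\<close>. Thus \<open>W\<close> never
        contains a vector and its negative, and dropping index \<open>i\<close> costs
        \<open>W\<close> only \<open>w\<close>.\<close>
      have "x \<noteq> - w" using aW[of x] aW[OF w(1)] x by auto
      then have "j \<noteq> i" using x i j by auto
      then show "x \<in> ?T" using j by (auto simp: signed_vectors_def)
    qed
    then have WF: "?W \<subseteq> ?F" using aW by (auto intro: hull_inc)
    \<comment> \<open>The redundant \<open>w\<close> can go without loss of dimension, so the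
      remaining points still span the facet hyperplane and \<open>?F\<close> is a facet of the
      smaller hull.\<close>
    have "affine hull W = affine hull ?W"
      using w hull_redundant[of w affine ?W] by (simp add: insert_absorb)
    then have "aff_dim ?W = aff_dim F" by (metis W(2) aff_dim_affine_hull aff_dim_convex_hull)
    also have "\<dots> = DIM(real^'k) - 1"
    proof -
      have "affine hull ?P = UNIV"
        using frame_interior[OF frame] by (intro affine_hull_nonempty_interior) auto
      then have "aff_dim ?P = DIM(real^'k)" using aff_dim_affine_hull[of ?P] by simp
      then show ?thesis using F by (simp add: facet_of_def)
    qed
    finally have dW: "aff_dim ?W = DIM(real^'k) - 1" .
    have full: "aff_dim (insert 0 X) = aff_dim X + 1" if "X \<subseteq> {x. a \<bullet> x = 1}" for X
      using zero_notin_affine_hull[OF that] by (simp add: aff_dim_insert)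
    have "aff_dim ?F + 1 \<le> DIM(real^'k)" using full[of ?F] aff_dim_le_DIM[of "insert 0 ?F"] by simp
    moreover have "aff_dim ?W \<le> aff_dim ?F" using WF by (rule aff_dim_subset)
    ultimately have dF: "aff_dim ?F = DIM(real^'k) - 1" using dW by simp
    \<comment> \<open>The points of \<open>?W\<close> span a hyperplane that misses the origin, so
      together with 0 they already have full dimension.\<close>
    have span: "span ?T = UNIV"
    proof -
      have "insert 0 ?W \<subseteq> span ?T" using WT by (auto intro: span_base span_zero)
      then have "aff_dim (insert 0 ?W) \<le> aff_dim (span ?T)" by (rule aff_dim_subset)
      moreover have "aff_dim (insert 0 ?W) = DIM(real^'k)" using full[of ?W] dW aW by auto
      ultimately have "aff_dim (span ?T) = DIM(real^'k)" using aff_dim_le_DIM[of "span ?T"] by linarith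
      then have "affine hull (span ?T) = UNIV" by (simp only: aff_dim_eq_full)
      moreover have "affine hull (span ?T) = span ?T"
        by (intro hull_same subspace_imp_affine subspace_span)
      ultimately show ?thesis by (simp only:)
    qed
    have "w \<noteq> 0" using aW[OF w(1)] by auto
    have "?W \<noteq> {}"
    proof
      assume "?W = {}"
      with w(2) show False by (simp only: affine_hull_empty empty_iff)
    qed
    have int: "0 \<in> interior (convex hull ?T)"
      using WT span \<open>?W \<noteq> {}\<close> by (intro zero_in_interior_convex_hull uminus_signed_vectors) auto
    have "convex hull ?T \<subseteq> ?P"
      unfolding symhull_eq by (rule hull_mono) (auto simp: signed_vectors_def)
    then have "?F face_of convex hull ?T"
      using aP by (intro face_of_Int_supporting_hyperplane_le) auto
    moreover have "?F \<noteq> {}" using WF \<open>?W \<noteq> {}\<close> by blast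
    moreover have "aff_dim (convex hull ?T) = DIM(real^'k)"
    proof -
      have "affine hull (convex hull ?T) = UNIV"
        using int by (intro affine_hull_nonempty_interior) auto
      then show ?thesis using aff_dim_affine_hull[of "convex hull ?T"] by simp
    qed
    ultimately have "?F facet_of convex hull ?T" using dF by (simp add: facet_of_def)
    moreover have "w \<in> affine hull ?F" using w(2) hull_mono[OF WF] by blast
    moreover have "S $ i \<noteq> 0" using i \<open>w \<noteq> 0\<close> by auto
    ultimately show False using local_max_no_kink[OF S _ max int] i by metis
  qed
  \<comment> \<open>A simplex of dimension \<open>m\<close> has \<open>m + 1\<close>
    vertices.\<close>
  then have "(int (card W) - 1) simplex F" unfolding simplex_def using W(2) by auto
  then show ?thesis by blast
qed

theorem theorem3:
  fixes S :: "(real^'k)^'n"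
  assumes "CARD('n) \<ge> CARD('k)" and "CARD('k) \<ge> 2"
    and "S \<in> Omega"
    and "\<exists>e>0. \<forall>S'\<in>Omega. dist S' S < e \<longrightarrow> vol_fun S' \<le> vol_fun S"
  shows "simplicial_polytope (symhull S) \<and>
         (\<forall>v. v extreme_point_of (symhull S) \<longrightarrow>
              norm v ^ 2 = measure lebesgue (star (symhull S) v) / measure lebesgue (symhull S))"
proof -
  have S: "uframe S" using assms(3) by (simp add: Omega_def)
  then have frame: "frame S" by (simp add: uframe_def)
  obtain e where e: "e > 0" "\<forall>S'\<in>Omega. dist S' S < e \<longrightarrow> vol_fun S' \<le> vol_fun S"
    using assms(4) by blast
  have "simplicial_polytope (symhull S)"
    unfolding simplicial_polytope_def using polytope_symhull facet_simplex[OF S e] by blast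
  moreover have "norm v ^ 2 = measure lebesgue (star (symhull S) v) / measure lebesgue (symhull S)"
    if v: "v extreme_point_of (symhull S)" for v
  proof -
    \<comment> \<open>The origin is interior, hence not a vertex. A vertex is some
      \<open>S $ i\<close> up to sign, and neither norm nor star sees the sign.\<close>
    have "v \<noteq> 0" using extreme_point_not_in_interior[OF v] frame_interior[OF frame] by auto
    moreover obtain i where i: "v = S $ i \<or> v = - (S $ i)"
      using extreme_point_of_convex_hull v unfolding symhull_def by blast
    ultimately have "measure lebesgue (star (symhull S) (S $ i)) = vol_fun S * (norm (S $ i))\<^sup>2"
      using local_max_norm[OF S _ e] by auto
    moreover have "star (symhull S) v = star (symhull S) (S $ i)" "norm v = norm (S $ i)"
      using i by (auto simp: star_uminus)
    ultimately show ?thesis using frame_vol_fun_pos[OF frame] by (simp add: vol_fun_def)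
  qed
  ultimately show ?thesis by blast
qed

end
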